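(* Let $h_0>0$ and let $(V_h)_{0\le h<h_0}$ be a family of smooth complex-valued potentials on $\mathbf{R}$ which, together with their derivatives of all orders, depend continuously on $h$. For $0<h<h_0$ let $H=H_h$ be some closed extension in $L^2(\mathbf{R})$ of the operator initially defined on $C_c^\infty(\mathbf{R})$ by $$Hf(x)=-h^2\frac{\mathrm{d}^2f}{\mathrm{d}x^2}(x)+V_h(x)f(x).$$ Let $a\in\mathbf{R}$ and $\eta\in\mathbf{R}\setminus\{0\}$, suppose that $\operatorname{Im}(V_0'(a))\neq 0$, and put $z=z_h:=\eta^2+V_h(a)$. Then there exists $\delta>0$ and, for each $n>0$, a positive constant $c_n$ (independent of $h$) and an $h$-dependent (and $n$-dependent) nonzero function $\tilde f\in C_c^\infty(\mathbf{R})$ such that if $0<h<\delta$ then $$\frac{\Vert H\tilde f-z\tilde f\Vert}{\Vert\tilde f\Vert}\le c_n h^n .$$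
   Context: $\Vert\cdot\Vert$ is the norm of $L^2(\mathbf{R})$, the space of complex-valued square-integrable functions. $V_h'$ denotes the derivative of $V_h$ with respect to $x$. That the potentials depend continuously on $h$ together with their derivatives of all orders means that for every integer $k\ge 0$ the map $(h,x)\mapsto V_h^{(k)}(x)$ is continuous on $[0,h_0)\times\mathbf{R}$. $C_c^\infty(\mathbf{R})$ is the space of complex-valued smooth compactly supported functions on $\mathbf{R}$. *)

theory Defs
  imports "HOL-Analysis.Analysis"
begin

section \<open>The space $L^2(\mathbf{R})$\<close>

text \<open>
  Complex-valued functions on the real line, square-integrable for Lebesgue measure, modulo
  equality almost everywhere. Borel measurable representatives suffice, since every Lebesgue
  measurable function is almost everywhere equal to a Borel measurable one.
\<close>

definition square_integrable :: "(real \<Rightarrow> complex) \<Rightarrow> bool" where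
  "square_integrable f \<longleftrightarrow>
     f \<in> borel_measurable lborel \<and> integrable lborel (\<lambda>x. (cmod (f x))\<^sup>2)"

lemma square_integrable_measurable [measurable_dest]:
  "square_integrable f \<Longrightarrow> f \<in> borel_measurable lborel"
  by (simp add: square_integrable_def)

lemma square_integrable_zero: "square_integrable (\<lambda>_. 0)"
  by (simp add: square_integrable_def)

lemma square_integrable_add:
  assumes "square_integrable f" "square_integrable g"
  shows "square_integrable (\<lambda>x. f x + g x)"
proof -
  have [measurable]: "f \<in> borel_measurable lborel" "g \<in> borel_measurable lborel"
    using assms by (auto simp: square_integrable_def)
  have le: "(cmod (f x + g x))\<^sup>2 \<le> 2 * (cmod (f x))\<^sup>2 + 2 * (cmod (g x))\<^sup>2" for x
  proof -
    have "(cmod (f x + g x))\<^sup>2 \<le> (cmod (f x) + cmod (g x))\<^sup>2"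
      by (intro power_mono norm_triangle_ineq) auto
    also have "\<dots> \<le> 2 * (cmod (f x))\<^sup>2 + 2 * (cmod (g x))\<^sup>2"
      using sum_squares_bound[of "cmod (f x)" "cmod (g x)"] by (simp add: power2_sum)
    finally show ?thesis .
  qed
  have "integrable lborel (\<lambda>x. 2 * (cmod (f x))\<^sup>2 + 2 * (cmod (g x))\<^sup>2)"
    using assms by (auto simp: square_integrable_def)
  then have "integrable lborel (\<lambda>x. (cmod (f x + g x))\<^sup>2)"
    by (rule Bochner_Integration.integrable_bound) (use le in auto)
  then show ?thesis
    by (simp add: square_integrable_def)
qed

lemma square_integrable_cmult:
  assumes "square_integrable f"
  shows "square_integrable (\<lambda>x. c * f x)"
  using assms by (auto simp: square_integrable_def norm_mult power_mult_distrib)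

lemma square_integrable_scaleR:
  "square_integrable f \<Longrightarrow> square_integrable (\<lambda>x. r *\<^sub>R f x)"
  using square_integrable_cmult[of f "of_real r"] by (simp add: scaleR_conv_of_real)

lemma square_integrable_uminus: "square_integrable f \<Longrightarrow> square_integrable (\<lambda>x. - f x)"
  using square_integrable_cmult[of f "-1"] by simp

lemma square_integrable_diff:
  "square_integrable f \<Longrightarrow> square_integrable g \<Longrightarrow> square_integrable (\<lambda>x. f x - g x)"
  using square_integrable_add[of f "\<lambda>x. - g x"] square_integrable_uminus[of g] by simp

lemma integrable_mult_cnj:
  assumes "square_integrable f" "square_integrable g"
  shows "integrable lborel (\<lambda>x. f x * cnj (g x))"
proof -
  have [measurable]: "f \<in> borel_measurable lborel" "g \<in> borel_measurable lborel"
    using assms by (auto simp: square_integrable_def)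
  have le: "cmod (f x) * cmod (g x) \<le> (cmod (f x))\<^sup>2 + (cmod (g x))\<^sup>2" for x
    using sum_squares_bound[of "cmod (f x)" "cmod (g x)"]
      mult_nonneg_nonneg[OF norm_ge_zero[of "f x"] norm_ge_zero[of "g x"]] by linarith
  have "integrable lborel (\<lambda>x. (cmod (f x))\<^sup>2 + (cmod (g x))\<^sup>2)"
    using assms by (auto simp: square_integrable_def)
  moreover have "(\<lambda>x. f x * cnj (g x)) \<in> borel_measurable lborel"
    by (intro borel_measurable_times borel_measurable_continuous_on[of cnj])
       (auto intro!: continuous_intros)
  ultimately show ?thesis
    by (rule Bochner_Integration.integrable_bound) (use le in \<open>auto simp: norm_mult\<close>)
qed

definition L2_rel :: "(real \<Rightarrow> complex) \<Rightarrow> (real \<Rightarrow> complex) \<Rightarrow> bool" where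
  "L2_rel f g \<longleftrightarrow>
     square_integrable f \<and> square_integrable g \<and> (AE x in lborel. f x = g x)"

lemma part_equivp_L2_rel: "part_equivp L2_rel"
proof (rule part_equivpI)
  show "\<exists>f. L2_rel f f"
    using square_integrable_zero by (auto simp: L2_rel_def)
  show "symp L2_rel"
    by (auto simp: L2_rel_def symp_def elim: AE_mp)
  show "transp L2_rel"
    unfolding transp_def L2_rel_def by (auto elim: AE_mp)
qed

text \<open>
  The abstraction function \<open>abs_L2\<close> sends a square-integrable function to its class; its value at
  other functions is unspecified.
\<close>

quotient_type L2 = "real \<Rightarrow> complex" / partial: L2_rel
  by (rule part_equivp_L2_rel)

instantiation L2 :: real_inner
begin

lift_definition zero_L2 :: L2 is "\<lambda>_. 0"
  by (simp add: L2_rel_def square_integrable_zero)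

lift_definition plus_L2 :: "L2 \<Rightarrow> L2 \<Rightarrow> L2" is "\<lambda>f g x. f x + g x"
  by (auto simp: L2_rel_def square_integrable_add)

lift_definition minus_L2 :: "L2 \<Rightarrow> L2 \<Rightarrow> L2" is "\<lambda>f g x. f x - g x"
  by (auto simp: L2_rel_def square_integrable_diff)

lift_definition uminus_L2 :: "L2 \<Rightarrow> L2" is "\<lambda>f x. - f x"
  by (auto simp: L2_rel_def square_integrable_uminus)

lift_definition scaleR_L2 :: "real \<Rightarrow> L2 \<Rightarrow> L2" is "\<lambda>r f x. r *\<^sub>R f x"
  by (auto simp: L2_rel_def square_integrable_scaleR)

lift_definition norm_L2 :: "L2 \<Rightarrow> real" is "\<lambda>f. sqrt (\<integral>x. (cmod (f x))\<^sup>2 \<partial>lborel)"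
proof -
  fix f g assume "L2_rel f g"
  then have "(\<integral>x. (cmod (f x))\<^sup>2 \<partial>lborel) = (\<integral>x. (cmod (g x))\<^sup>2 \<partial>lborel)"
    by (intro integral_cong_AE) (auto simp: L2_rel_def square_integrable_def)
  then show "sqrt (\<integral>x. (cmod (f x))\<^sup>2 \<partial>lborel) = sqrt (\<integral>x. (cmod (g x))\<^sup>2 \<partial>lborel)"
    by simp
qed

lift_definition inner_L2 :: "L2 \<Rightarrow> L2 \<Rightarrow> real" is
  "\<lambda>f g. Re (\<integral>x. f x * cnj (g x) \<partial>lborel)"
proof -
  fix f f' g g' assume "L2_rel f f'" "L2_rel g g'"
  then have "(\<integral>x. f x * cnj (g x) \<partial>lborel) = (\<integral>x. f' x * cnj (g' x) \<partial>lborel)"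
    by (intro integral_cong_AE borel_measurable_integrable integrable_mult_cnj)
       (auto simp: L2_rel_def)
  then show "Re (\<integral>x. f x * cnj (g x) \<partial>lborel) = Re (\<integral>x. f' x * cnj (g' x) \<partial>lborel)"
    by simp
qed

definition dist_L2 :: "L2 \<Rightarrow> L2 \<Rightarrow> real" where
  "dist_L2 x y = norm (x - y)"

definition sgn_L2 :: "L2 \<Rightarrow> L2" where
  "sgn_L2 x = inverse (norm x) *\<^sub>R x"

definition uniformity_L2 :: "(L2 \<times> L2) filter" where
  "uniformity_L2 = (INF e\<in>{0<..}. principal {(x, y). dist x y < e})"

definition open_L2 :: "L2 set \<Rightarrow> bool" where
  "open_L2 U \<longleftrightarrow> (\<forall>x\<in>U. \<forall>\<^sub>F (x', y) in uniformity. x' = x \<longrightarrow> y \<in> U)"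

instance
proof
  fix x y z :: L2 and r s :: real and U :: "L2 set"
  show "x + y + z = x + (y + z)"
    by transfer
       (auto simp: L2_rel_def add.assoc square_integrable_add)
  show "x + y = y + x"
    by transfer (auto simp: L2_rel_def add.commute square_integrable_add)
  show "0 + x = x"
    by transfer (auto simp: L2_rel_def)
  show "- x + x = 0"
    by transfer (auto simp: L2_rel_def square_integrable_zero)
  show "x - y = x + - y"
    by transfer (auto simp: L2_rel_def square_integrable_diff)
  show "r *\<^sub>R (x + y) = r *\<^sub>R x + r *\<^sub>R y"
    by transfer
       (auto simp: L2_rel_def scaleR_add_right intro!: square_integrable_add square_integrable_scaleR)
  show "(r + s) *\<^sub>R x = r *\<^sub>R x + s *\<^sub>R x"
    by transfer
       (auto simp: L2_rel_def scaleR_add_left intro!: square_integrable_add square_integrable_scaleR)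
  show "r *\<^sub>R s *\<^sub>R x = (r * s) *\<^sub>R x"
    by transfer (auto simp: L2_rel_def square_integrable_scaleR)
  show "1 *\<^sub>R x = x"
    by transfer (auto simp: L2_rel_def)
  show "dist x y = norm (x - y)"
    by (rule dist_L2_def)
  show "sgn x = inverse (norm x) *\<^sub>R x"
    by (rule sgn_L2_def)
  show "uniformity = (INF e\<in>{0<..}. principal {(x :: L2, y). dist x y < e})"
    by (rule uniformity_L2_def)
  show "open U = (\<forall>x\<in>U. \<forall>\<^sub>F (x', y) in uniformity. x' = x \<longrightarrow> y \<in> U)"
    by (rule open_L2_def)
  show "inner x y = inner y x"
  proof transfer
    fix f g assume "L2_rel f f" "L2_rel g g"
    have "(\<integral>x. g x * cnj (f x) \<partial>lborel) = (\<integral>x. cnj (f x * cnj (g x)) \<partial>lborel)"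
      by (simp add: mult.commute)
    also have "\<dots> = cnj (\<integral>x. f x * cnj (g x) \<partial>lborel)"
      by (rule Bochner_Integration.integral_cnj)
    finally show "Re (\<integral>x. f x * cnj (g x) \<partial>lborel) = Re (\<integral>x. g x * cnj (f x) \<partial>lborel)"
      by simp
  qed
  show "inner (x + y) z = inner x z + inner y z"
    by transfer (simp add: L2_rel_def distrib_right integrable_mult_cnj)
  show "inner (r *\<^sub>R x) y = r * inner x y"
    by transfer simp
  have inner_self: "Re (\<integral>x. f x * cnj (f x) \<partial>lborel) = (\<integral>x. (cmod (f x))\<^sup>2 \<partial>lborel)"
    for f :: "real \<Rightarrow> complex"
    by (simp flip: complex_norm_square of_real_power)
  show "0 \<le> inner x x"
    by transfer (simp add: inner_self)
  show "(inner x x = 0) = (x = 0)"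
    unfolding atomize_eq
  proof transfer
    fix f assume "L2_rel f f"
    then have "((\<integral>x. (cmod (f x))\<^sup>2 \<partial>lborel) = 0) = (AE x in lborel. (cmod (f x))\<^sup>2 = 0)"
      by (intro integral_nonneg_eq_0_iff_AE) (auto simp: L2_rel_def square_integrable_def)
    then show "(Re (\<integral>x. f x * cnj (f x) \<partial>lborel) = 0) = L2_rel f (\<lambda>_. 0)"
      using \<open>L2_rel f f\<close>
      by (simp only: inner_self) (simp add: L2_rel_def square_integrable_zero)
  qed
  show "norm x = sqrt (inner x x)"
    by transfer (simp only: inner_self)
qed

end

lift_definition scaleC_L2 :: "complex \<Rightarrow> L2 \<Rightarrow> L2" (infixr "*\<^sub>C" 75) is "\<lambda>c f x. c * f x"
  by (auto simp: L2_rel_def square_integrable_cmult)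

lemma norm_abs_L2:
  "square_integrable f \<Longrightarrow> norm (abs_L2 f) = sqrt (\<integral>x. (cmod (f x))\<^sup>2 \<partial>lborel)"
  by (simp add: norm_L2.abs_eq L2_rel_def)


section \<open>Closed operators\<close>

text \<open>
  An unbounded operator is given by its domain \<open>D\<close> and a map \<open>T\<close> whose values outside \<open>D\<close> are
  irrelevant.
\<close>

definition linear_operator :: "L2 set \<Rightarrow> (L2 \<Rightarrow> L2) \<Rightarrow> bool" where
  "linear_operator D T \<longleftrightarrow>
     0 \<in> D \<and>
     (\<forall>u\<in>D. \<forall>v\<in>D. u + v \<in> D \<and> T (u + v) = T u + T v) \<and>
     (\<forall>c. \<forall>u\<in>D. c *\<^sub>C u \<in> D \<and> T (c *\<^sub>C u) = c *\<^sub>C T u)"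

definition closed_operator :: "L2 set \<Rightarrow> (L2 \<Rightarrow> L2) \<Rightarrow> bool" where
  "closed_operator D T \<longleftrightarrow> linear_operator D T \<and> closed {(u, T u) | u. u \<in> D}"


section \<open>Smooth functions and Schroedinger operators\<close>

definition nth_deriv :: "nat \<Rightarrow> (real \<Rightarrow> complex) \<Rightarrow> real \<Rightarrow> complex" where
  "nth_deriv k f = ((\<lambda>g x. vector_derivative g (at x)) ^^ k) f"

definition smooth :: "(real \<Rightarrow> complex) \<Rightarrow> bool" where
  "smooth f \<longleftrightarrow> (\<forall>k x. nth_deriv k f differentiable at x)"

definition test_functions :: "(real \<Rightarrow> complex) set" where
  "test_functions = {f. smooth f \<and> compact (closure {x. f x \<noteq> 0})}"

definition schroedinger :: "real \<Rightarrow> (real \<Rightarrow> complex) \<Rightarrow> (real \<Rightarrow> complex) \<Rightarrow> real \<Rightarrow> complex" where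
  "schroedinger h W f = (\<lambda>x. - (of_real h)\<^sup>2 * nth_deriv 2 f x + W x * f x)"

definition closed_extension ::
    "((real \<Rightarrow> complex) \<Rightarrow> real \<Rightarrow> complex) \<Rightarrow> L2 set \<Rightarrow> (L2 \<Rightarrow> L2) \<Rightarrow> bool" where
  "closed_extension A D T \<longleftrightarrow>
     closed_operator D T \<and>
     (\<forall>f\<in>test_functions. abs_L2 f \<in> D \<and> T (abs_L2 f) = abs_L2 (A f))"

text \<open>
  For \<open>A = schroedinger h W\<close> with \<open>W\<close> smooth, \<open>closed_extension\<close> applies \<open>abs_L2\<close> to
  square-integrable functions only, as the following lemmas show.
\<close>

lemma smooth_continuous: "smooth f \<Longrightarrow> continuous_on UNIV (nth_deriv k f)"
  by (auto simp: smooth_def intro!: differentiable_imp_continuous_on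
        intro: differentiable_at_withinI simp: differentiable_on_def)

lemma square_integrable_compact_support:
  assumes cont: "continuous_on UNIV f" and K: "compact K" and zero: "\<And>x. x \<notin> K \<Longrightarrow> f x = 0"
  shows "square_integrable f"
proof -
  have [measurable]: "f \<in> borel_measurable borel"
    using cont by (rule borel_measurable_continuous_onI)
  have "integrable lborel (\<lambda>x. indicator K x *\<^sub>R (cmod (f x))\<^sup>2)"
    by (intro borel_integrable_compact K continuous_intros continuous_on_subset[OF cont]) auto
  moreover have "(\<lambda>x. indicator K x *\<^sub>R (cmod (f x))\<^sup>2) = (\<lambda>x. (cmod (f x))\<^sup>2)"
    using zero by (auto simp: fun_eq_iff indicator_def)
  ultimately show ?thesis
    by (simp add: square_integrable_def)
qed

lemma square_integrable_test_function:
  assumes "f \<in> test_functions"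
  shows "square_integrable f"
proof (rule square_integrable_compact_support)
  show "continuous_on UNIV f"
    using assms smooth_continuous[of f 0] by (simp add: test_functions_def nth_deriv_def)
  show "compact (closure {x. f x \<noteq> 0})"
    using assms by (simp add: test_functions_def)
  show "f x = 0" if "x \<notin> closure {x. f x \<noteq> 0}" for x
    using that closure_subset[of "{x. f x \<noteq> 0}"] by auto
qed

lemma square_integrable_schroedinger:
  assumes f: "f \<in> test_functions" and W: "smooth W"
  shows "square_integrable (schroedinger h W f)"
proof (rule square_integrable_compact_support)
  let ?K = "closure {x. f x \<noteq> 0}"
  have "smooth f" using f by (simp add: test_functions_def)
  then show "continuous_on UNIV (schroedinger h W f)"
    unfolding schroedinger_def
    using smooth_continuous[of f 0] smooth_continuous[of f 2] smooth_continuous[of W 0] W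
    by (intro continuous_intros) (auto simp: nth_deriv_def)
  show "compact ?K"
    using f by (simp add: test_functions_def)
  have deriv_zero: "nth_deriv k f x = 0" if "x \<notin> ?K" for k x
    using that
  proof (induction k arbitrary: x)
    case 0
    then show ?case
      using closure_subset[of "{x. f x \<noteq> 0}"] by (auto simp: nth_deriv_def)
  next
    case (Suc k)
    have "((\<lambda>_. 0) has_vector_derivative 0) (at x)"
      by simp
    then have "(nth_deriv k f has_vector_derivative 0) (at x)"
      by (rule has_vector_derivative_transform_within_open[where S = "- ?K"])
         (use Suc in auto)
    then show ?case
      by (simp add: nth_deriv_def vector_derivative_at)
  qed
  show "schroedinger h W f x = 0" if "x \<notin> ?K" for x
    using deriv_zero[OF that, of 2] deriv_zero[OF that, of 0]
    by (simp add: schroedinger_def nth_deriv_def)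
qed

end

theory Submission
  imports Defs
begin

text \<open>
  The proof is a complex WKB construction. One looks for \<open>f = exp (\<Phi> / h)\<close> with \<open>\<Phi>' = v\<close>; then
  \<open>- h^2 f'' + (V_h - z) f = - (v^2 + h v' - W) f\<close> with \<open>W = V_h - z_h\<close>, so one needs an approximate
  solution of the Riccati equation \<open>v^2 + h v' = W\<close>. To leading order \<open>v\<close> is a square root \<open>w\<close> of
  \<open>W = - (\<eta>^2 + V_h(a) - V_h(x))\<close>, smooth near \<open>a\<close> since \<open>\<eta> \<noteq> 0\<close>. Corrections divisible by \<open>h\<close>, computed
  algebraically from \<open>w\<close> and its derivatives, reduce the residual to \<open>O(h^n)\<close> (\<open>riccati_approx\<close>).

  At \<open>a\<close> the root \<open>w\<close> is purely imaginary, \<open>w(a) = \<i> \<sigma> |\<eta>|\<close> with a free sign \<open>\<sigma>\<close>, and the real part of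
  \<open>w'(a)\<close> is close to \<open>\<sigma> Im V_0'(a) / (2 |\<eta>|)\<close> for small \<open>h\<close>. The hypothesis \<open>Im V_0'(a) \<noteq> 0\<close> thus allows a choice of sign for which
  the real part of \<open>\<Phi>\<close> is at most \<open>- c (x - a)^2 + O(h |x - a|)\<close> (\<open>phase_neighbourhood\<close>, \<open>Re_phase_derivative_sign\<close>,
  \<open>phase_bounds\<close>). So \<open>f\<close> is concentrated at \<open>a\<close> like a Gaussian, and multiplying it by a cutoff that
  equals one near \<open>a\<close> introduces an error that is exponentially small in \<open>1 / h\<close>
  (\<open>wkb_quasimode\<close>). The norm of \<open>f\<close> is bounded below by a constant times \<open>h^(1/2)\<close>, simply
  because \<open>|f|\<close> is bounded below on \<open>{a..a + h}\<close>; a power of \<open>h\<close> is harmless against an exponential.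

  Uniformity in \<open>h\<close> of all constants is handled by the notion \<open>unif_smooth\<close> of a family with
  derivatives of all orders locally bounded uniformly in \<open>h\<close>. The neighbourhood of \<open>(0, a)\<close> and hence \<open>\<delta>\<close> are
  determined by \<open>w\<close>, and do not depend on \<open>n\<close>. Since \<open>f\<close> is a test function, every closed extension
  \<open>H\<close> acts on it as the differential expression.
\<close>

section \<open>Families of functions with uniformly bounded derivatives\<close>

text \<open>
  Every estimate of the proof has to be uniform in \<open>h\<close> on compact sets of \<open>x\<close>. Families indexed
  by \<open>h\<close>, all of whose \<open>x\<close>-derivatives are locally bounded in this sense, form an algebra closed
  under differentiation, so that uniformity of a formula in \<open>V\<close> and its derivatives follows from
  the shape of the formula.
\<close>
definition locally_bounded :: "'i set \<Rightarrow> real set \<Rightarrow> ('i \<Rightarrow> real \<Rightarrow> complex) \<Rightarrow> bool" where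
  "locally_bounded P S g \<longleftrightarrow>
     (\<forall>K. compact K \<and> K \<subseteq> S \<longrightarrow> (\<exists>B. \<forall>h\<in>P. \<forall>x\<in>K. cmod (g h x) \<le> B))"

text \<open>
  The derivative is an existentially quantified witness rather than \<open>vector_derivative\<close>: closure
  under an operation then amounts to exhibiting the formula of the derivative, and only points
  of \<open>S\<close> matter.
\<close>
primrec unif_diff :: "nat \<Rightarrow> 'i set \<Rightarrow> real set \<Rightarrow> ('i \<Rightarrow> real \<Rightarrow> complex) \<Rightarrow> bool" where
  "unif_diff 0 P S g \<longleftrightarrow> locally_bounded P S g"
| "unif_diff (Suc k) P S g \<longleftrightarrow> locally_bounded P S g \<and>
     (\<exists>g'. (\<forall>h\<in>P. \<forall>x\<in>S. (g h has_vector_derivative g' h x) (at x)) \<and> unif_diff k P S g')"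

definition unif_smooth :: "'i set \<Rightarrow> real set \<Rightarrow> ('i \<Rightarrow> real \<Rightarrow> complex) \<Rightarrow> bool" where
  "unif_smooth P S g \<longleftrightarrow> (\<forall>k. unif_diff k P S g)"

lemma locally_boundedD:
  assumes "locally_bounded P S g" "compact K" "K \<subseteq> S"
  obtains B where "B \<ge> 0" "\<And>h x. h \<in> P \<Longrightarrow> x \<in> K \<Longrightarrow> cmod (g h x) \<le> B"
proof -
  obtain B where B: "\<forall>h\<in>P. \<forall>x\<in>K. cmod (g h x) \<le> B"
    using assms unfolding locally_bounded_def by blast
  have "max B 0 \<ge> 0" by simp
  moreover have "cmod (g h x) \<le> max B 0" if "h \<in> P" "x \<in> K" for h x
    using B that by (meson le_max_iff_disj)
  ultimately show thesis using that by blast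
qed

lemma locally_bounded_const_in_x:
  assumes "\<And>h. h \<in> P \<Longrightarrow> cmod (c h) \<le> B"
  shows "locally_bounded P S (\<lambda>h x. c h)"
  using assms unfolding locally_bounded_def by blast

lemma locally_bounded_add:
  assumes "locally_bounded P S f" "locally_bounded P S g"
  shows "locally_bounded P S (\<lambda>h x. f h x + g h x)"
  unfolding locally_bounded_def
proof (intro allI impI)
  fix K assume K: "compact K \<and> K \<subseteq> S"
  obtain A where A: "\<And>h x. h \<in> P \<Longrightarrow> x \<in> K \<Longrightarrow> cmod (f h x) \<le> A"
    using locally_boundedD[OF assms(1)] K by metis
  obtain B where B: "\<And>h x. h \<in> P \<Longrightarrow> x \<in> K \<Longrightarrow> cmod (g h x) \<le> B"
    using locally_boundedD[OF assms(2)] K by metis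
  show "\<exists>B. \<forall>h\<in>P. \<forall>x\<in>K. cmod (f h x + g h x) \<le> B"
    using A B norm_triangle_mono by blast
qed

lemma locally_bounded_mult:
  assumes "locally_bounded P S f" "locally_bounded P S g"
  shows "locally_bounded P S (\<lambda>h x. f h x * g h x)"
  unfolding locally_bounded_def
proof (intro allI impI)
  fix K assume K: "compact K \<and> K \<subseteq> S"
  obtain A where A: "A \<ge> 0" "\<And>h x. h \<in> P \<Longrightarrow> x \<in> K \<Longrightarrow> cmod (f h x) \<le> A"
    using locally_boundedD[OF assms(1)] K by metis
  obtain B where B: "\<And>h x. h \<in> P \<Longrightarrow> x \<in> K \<Longrightarrow> cmod (g h x) \<le> B"
    using locally_boundedD[OF assms(2)] K by metis
  show "\<exists>B. \<forall>h\<in>P. \<forall>x\<in>K. cmod (f h x * g h x) \<le> B"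
    using A B by (intro exI[of _ "A * B"]) (auto simp: norm_mult intro!: mult_mono)
qed

lemma locally_bounded_single:
  assumes "continuous_on S f"
  shows "locally_bounded P S (\<lambda>_. f)"
  unfolding locally_bounded_def
proof (intro allI impI)
  fix K assume K: "compact K \<and> K \<subseteq> S"
  then have "bounded (f ` K)"
    using assms by (intro compact_imp_bounded compact_continuous_image) (auto intro: continuous_on_subset)
  then show "\<exists>B. \<forall>h\<in>P. \<forall>x\<in>K. cmod (f x) \<le> B"
    unfolding bounded_iff by auto
qed

lemma unif_diff_locally_bounded: "unif_diff k P S g \<Longrightarrow> locally_bounded P S g"
  by (cases k) auto

lemma unif_smooth_locally_bounded: "unif_smooth P S g \<Longrightarrow> locally_bounded P S g"
  using unif_diff_locally_bounded unfolding unif_smooth_def by blast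

lemma unif_diff_mono: "unif_diff (Suc k) P S g \<Longrightarrow> unif_diff k P S g"
  by (induction k arbitrary: g) auto

lemma unif_diff_cong:
  assumes "unif_diff k P S g" "open S" "\<And>h x. h \<in> P \<Longrightarrow> x \<in> S \<Longrightarrow> f h x = g h x"
  shows "unif_diff k P S f"
proof -
  have lb: "locally_bounded P S f"
    using unif_diff_locally_bounded[OF assms(1)] assms(3)
    unfolding locally_bounded_def by (metis subsetD)
  show ?thesis
  proof (cases k)
    case 0
    then show ?thesis using lb by simp
  next
    case (Suc j)
    then obtain g' where g': "\<And>h x. h \<in> P \<Longrightarrow> x \<in> S \<Longrightarrow> (g h has_vector_derivative g' h x) (at x)"
      "unif_diff j P S g'"
      using assms(1) by auto
    have "(f h has_vector_derivative g' h x) (at x)" if "h \<in> P" "x \<in> S" for h x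
      using g'(1)[OF that] \<open>open S\<close>
      by (rule has_vector_derivative_transform_within_open) (use that assms(3) in auto)
    then show ?thesis
      using Suc lb g'(2) by auto
  qed
qed

lemma unif_smooth_cong:
  assumes "unif_smooth P S g" "open S" "\<And>h x. h \<in> P \<Longrightarrow> x \<in> S \<Longrightarrow> f h x = g h x"
  shows "unif_smooth P S f"
  using assms unif_diff_cong unfolding unif_smooth_def by metis

lemma unif_smooth_subset:
  assumes "unif_smooth P S g" "Q \<subseteq> P" "T \<subseteq> S"
  shows "unif_smooth Q T g"
proof -
  have lb: "locally_bounded Q T g" if "locally_bounded P S g" for g
    using that assms(2,3) unfolding locally_bounded_def by (meson subsetD subset_trans)
  have "unif_diff k Q T g" if "unif_diff k P S g" for k g
    using that
  proof (induction k arbitrary: g)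
    case 0
    then show ?case using lb by auto
  next
    case (Suc k)
    then show ?case using lb assms(2,3) by (auto; blast)
  qed
  then show ?thesis
    using assms(1) unfolding unif_smooth_def by blast
qed

text \<open>
  A member of a family is treated as a family over the one-point index set \<open>{()}\<close>, so that ordinary
  smooth functions and families share one calculus.
\<close>
lemma unif_smooth_member:
  assumes "unif_smooth P S g" "h \<in> P"
  shows "unif_smooth {()} S (\<lambda>_. g h)"
proof -
  have lb: "locally_bounded {()} S (\<lambda>_. g h)" if g: "locally_bounded P S g" for g
    unfolding locally_bounded_def
  proof (intro allI impI)
    fix K assume "compact K \<and> K \<subseteq> S"
    then obtain B where "\<And>h x. h \<in> P \<Longrightarrow> x \<in> K \<Longrightarrow> cmod (g h x) \<le> B"
      using locally_boundedD[OF g] by metis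
    then show "\<exists>B. \<forall>i\<in>{()}. \<forall>x\<in>K. cmod (g h x) \<le> B"
      using \<open>h \<in> P\<close> by auto
  qed
  have "unif_diff k {()} S (\<lambda>_. g h)" if "unif_diff k P S g" for k g
    using that
  proof (induction k arbitrary: g)
    case 0
    then show ?case using lb by simp
  next
    case (Suc k)
    from Suc.prems obtain g' where g': "\<forall>h\<in>P. \<forall>x\<in>S. (g h has_vector_derivative g' h x) (at x)"
      "unif_diff k P S g'"
      unfolding unif_diff.simps by blast
    show ?case
      unfolding unif_diff.simps
      using lb[OF unif_diff_locally_bounded[OF Suc.prems]] Suc.IH[OF g'(2)] g'(1) \<open>h \<in> P\<close>
      by (intro conjI exI[of _ "\<lambda>_. g' h"]) auto
  qed
  then show ?thesis
    using assms(1) by (simp add: unif_smooth_def)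
qed

lemma unif_diff_const_in_x:
  assumes "\<And>h. h \<in> P \<Longrightarrow> cmod (c h) \<le> B"
  shows "unif_diff k P S (\<lambda>h x. c h)"
  using assms
proof (induction k arbitrary: c B)
  case 0
  then show ?case by (auto intro: locally_bounded_const_in_x)
next
  case (Suc k)
  have "unif_diff k P S (\<lambda>h x. 0)"
    using Suc.IH[of "\<lambda>_. 0" 0] by simp
  then show ?case
    using locally_bounded_const_in_x[OF Suc.prems]
    by (auto intro!: exI[of _ "\<lambda>h x. 0"])
qed

lemma unif_smooth_const_in_x:
  assumes "\<And>h. h \<in> P \<Longrightarrow> cmod (c h) \<le> B"
  shows "unif_smooth P S (\<lambda>h x. c h)"
  unfolding unif_smooth_def using unif_diff_const_in_x[where c = c and B = B, OF assms] by blast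

lemma unif_smooth_const: "unif_smooth P S (\<lambda>h x. c)"
  by (rule unif_smooth_const_in_x) (rule order_refl)

lemma unif_diff_add:
  assumes "unif_diff k P S f" "unif_diff k P S g"
  shows "unif_diff k P S (\<lambda>h x. f h x + g h x)"
  using assms
proof (induction k arbitrary: f g)
  case 0
  then show ?case by (auto intro: locally_bounded_add)
next
  case (Suc k)
  from Suc.prems obtain f' g' where
    "\<And>h x. h \<in> P \<Longrightarrow> x \<in> S \<Longrightarrow> (f h has_vector_derivative f' h x) (at x)" "unif_diff k P S f'"
    "\<And>h x. h \<in> P \<Longrightarrow> x \<in> S \<Longrightarrow> (g h has_vector_derivative g' h x) (at x)" "unif_diff k P S g'"
    unfolding unif_diff.simps by blast
  then show ?case
    using Suc locally_bounded_add[of P S f g]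
    by (auto intro!: exI[of _ "\<lambda>h x. f' h x + g' h x"] has_vector_derivative_add)
qed

lemma unif_diff_mult:
  assumes "unif_diff k P S f" "unif_diff k P S g"
  shows "unif_diff k P S (\<lambda>h x. f h x * g h x)"
  using assms
proof (induction k arbitrary: f g)
  case 0
  then show ?case by (auto intro: locally_bounded_mult)
next
  case (Suc k)
  from Suc.prems obtain f' g' where *:
    "\<And>h x. h \<in> P \<Longrightarrow> x \<in> S \<Longrightarrow> (f h has_vector_derivative f' h x) (at x)" "unif_diff k P S f'"
    "\<And>h x. h \<in> P \<Longrightarrow> x \<in> S \<Longrightarrow> (g h has_vector_derivative g' h x) (at x)" "unif_diff k P S g'"
    unfolding unif_diff.simps by blast
  have "unif_diff k P S f" "unif_diff k P S g"
    using Suc.prems unif_diff_mono by blast+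
  then have "unif_diff k P S (\<lambda>h x. f h x * g' h x + f' h x * g h x)"
    by (intro unif_diff_add Suc.IH *)
  then show ?case
    using Suc.prems * locally_bounded_mult[of P S f g]
    by (auto intro!: exI[of _ "\<lambda>h x. f h x * g' h x + f' h x * g h x"] has_vector_derivative_mult)
qed

lemma unif_smooth_add:
  "unif_smooth P S f \<Longrightarrow> unif_smooth P S g \<Longrightarrow> unif_smooth P S (\<lambda>h x. f h x + g h x)"
  by (simp add: unif_smooth_def unif_diff_add)

lemma unif_smooth_mult:
  "unif_smooth P S f \<Longrightarrow> unif_smooth P S g \<Longrightarrow> unif_smooth P S (\<lambda>h x. f h x * g h x)"
  by (simp add: unif_smooth_def unif_diff_mult)

lemma unif_smooth_minus: "unif_smooth P S f \<Longrightarrow> unif_smooth P S (\<lambda>h x. - f h x)"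
  using unif_smooth_mult[OF unif_smooth_const[of P S "-1"], of f] by simp

lemma unif_smooth_diff:
  "unif_smooth P S f \<Longrightarrow> unif_smooth P S g \<Longrightarrow> unif_smooth P S (\<lambda>h x. f h x - g h x)"
  using unif_smooth_add[OF _ unif_smooth_minus[of P S g], of f] by simp

text \<open>
  The closure property behind inverses, square roots, exponentials and antiderivatives: each of
  these solves a first-order equation whose right-hand side is as regular as the solution itself,
  so regularity is gained one derivative at a time.
\<close>
lemma unif_smooth_bootstrap:
  assumes lb: "locally_bounded P S y"
    and der: "\<And>h x. h \<in> P \<Longrightarrow> x \<in> S \<Longrightarrow> (y h has_vector_derivative y' h x) (at x)"
    and step: "\<And>k. unif_diff k P S y \<Longrightarrow> unif_diff k P S y'"
  shows "unif_smooth P S y"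
proof -
  have "unif_diff k P S y" for k
  proof (induction k)
    case 0
    then show ?case using lb by simp
  next
    case (Suc k)
    then show ?case using lb der step by auto
  qed
  then show ?thesis by (simp add: unif_smooth_def)
qed

abbreviation dx :: "('i \<Rightarrow> real \<Rightarrow> complex) \<Rightarrow> 'i \<Rightarrow> real \<Rightarrow> complex" where
  "dx g \<equiv> \<lambda>h x. vector_derivative (g h) (at x)"

lemma unif_diff_dx:
  assumes "unif_diff (Suc k) P S g" "open S"
  shows "unif_diff k P S (dx g)"
proof -
  obtain g' where g': "\<And>h x. h \<in> P \<Longrightarrow> x \<in> S \<Longrightarrow> (g h has_vector_derivative g' h x) (at x)"
    "unif_diff k P S g'"
    using assms(1) by auto
  show ?thesis
    by (rule unif_diff_cong[OF g'(2) assms(2)]) (auto intro!: vector_derivative_at g'(1))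
qed

lemma unif_smooth_dx: "unif_smooth P S g \<Longrightarrow> open S \<Longrightarrow> unif_smooth P S (dx g)"
  using unif_diff_dx unfolding unif_smooth_def by blast

lemma unif_smooth_has_dx:
  assumes "unif_smooth P S g" "h \<in> P" "x \<in> S"
  shows "(g h has_vector_derivative dx g h x) (at x)"
proof -
  have "unif_diff (Suc 0) P S g" using assms unfolding unif_smooth_def by blast
  then show ?thesis using assms(2,3) vector_derivative_at by fastforce
qed

lemma unif_smooth_continuous:
  assumes "unif_smooth P S g" "h \<in> P"
  shows "continuous_on S (g h)"
  using unif_smooth_has_dx[OF assms(1,2)]
  by (meson continuous_at_imp_continuous_on has_vector_derivative_continuous)

lemma nth_deriv_Suc: "nth_deriv (Suc k) f = (\<lambda>x. vector_derivative (nth_deriv k f) (at x))"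
  by (simp add: nth_deriv_def)

lemma nth_deriv_Suc': "nth_deriv (Suc k) f = nth_deriv k (\<lambda>x. vector_derivative f (at x))"
  by (simp only: nth_deriv_def funpow_Suc_right o_apply)

lemma nth_deriv_0: "nth_deriv 0 f = f"
  by (simp add: nth_deriv_def)

lemma nth_deriv_2:
  assumes "open S" "x \<in> S" "\<And>y. y \<in> S \<Longrightarrow> (f has_vector_derivative f1 y) (at y)"
    and "(f1 has_vector_derivative f2) (at x)"
  shows "nth_deriv 2 f x = f2"
proof -
  have "((\<lambda>y. vector_derivative f (at y)) has_vector_derivative f2) (at x)"
    using assms(4,1,2)
    by (rule has_vector_derivative_transform_within_open) (use assms(3) vector_derivative_at in metis)
  then show ?thesis
    by (simp add: nth_deriv_def numeral_2_eq_2 vector_derivative_at)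
qed

lemma unif_smooth_nth_deriv:
  assumes "unif_smooth P S g" "open S"
  shows "unif_smooth P S (\<lambda>h. nth_deriv k (g h))"
  using assms(1)
proof (induction k arbitrary: g)
  case 0
  then show ?case by (simp add: nth_deriv_0)
next
  case (Suc k)
  from Suc.IH[OF unif_smooth_dx[OF Suc.prems assms(2)]]
  show ?case by (simp add: nth_deriv_Suc')
qed

lemma unif_smooth_imp_differentiable:
  assumes "unif_smooth P S g" "open S" "h \<in> P" "x \<in> S"
  shows "nth_deriv k (g h) differentiable at x"
  using unif_smooth_has_dx[OF unif_smooth_nth_deriv[OF assms(1,2)] assms(3,4)]
  by (metis differentiableI_vector)

text \<open>
  Smoothness is a local property; this glues the truncated WKB function, which is smooth where the
  phase is defined, to zero outside the support of the cutoff.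
\<close>
lemma smooth_locally:
  assumes "\<And>x. \<exists>S. open S \<and> x \<in> S \<and> unif_smooth {()} S (\<lambda>_. f)"
  shows "smooth f"
  unfolding smooth_def
proof (intro allI)
  fix k x
  obtain S where "open S" "x \<in> S" "unif_smooth {()} S (\<lambda>_. f)"
    using assms by blast
  then show "nth_deriv k f differentiable at x"
    using unif_smooth_imp_differentiable[of "{()}" S "\<lambda>_. f" "()" x k] by simp
qed

text \<open>
  Joint continuity gives bounds on \<open>J \<times> K\<close> by compactness. When \<open>P\<close> accumulates at \<open>0\<close>, the set \<open>J\<close>
  contains \<open>0\<close>; this is how continuity at \<open>h = 0\<close> prevents the bounds from blowing up as \<open>h\<close> tends to zero.
\<close>
lemma unif_smooth_continuous_family:
  assumes smooth: "\<And>h. h \<in> P \<Longrightarrow> smooth (V h)"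
    and cont: "\<And>k. continuous_on (T \<times> UNIV) (\<lambda>(h, x). nth_deriv k (V h) x)"
    and J: "compact J" "P \<subseteq> J" "J \<subseteq> T"
  shows "unif_smooth P UNIV V"
proof -
  have lb: "locally_bounded P UNIV (\<lambda>h. nth_deriv j (V h))" for j
    unfolding locally_bounded_def
  proof (intro allI impI)
    fix K :: "real set" assume K: "compact K \<and> K \<subseteq> UNIV"
    have "compact ((\<lambda>(h, x). nth_deriv j (V h) x) ` (J \<times> K))"
      using K J by (intro compact_continuous_image continuous_on_subset[OF cont] compact_Times) auto
    then have "bounded ((\<lambda>(h, x). nth_deriv j (V h) x) ` (J \<times> K))"
      by (rule compact_imp_bounded)
    then obtain B where "\<forall>y\<in>(\<lambda>(h, x). nth_deriv j (V h) x) ` (J \<times> K). cmod y \<le> B"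
      unfolding bounded_iff ..
    then show "\<exists>B. \<forall>h\<in>P. \<forall>x\<in>K. cmod (nth_deriv j (V h) x) \<le> B"
      using J(2) by (intro exI[of _ B]) auto
  qed
  have "unif_diff k P UNIV (\<lambda>h. nth_deriv j (V h))" for k j
  proof (induction k arbitrary: j)
    case 0
    then show ?case using lb by simp
  next
    case (Suc k)
    have "(nth_deriv j (V h) has_vector_derivative nth_deriv (Suc j) (V h) x) (at x)" if "h \<in> P" for h x
      using smooth[OF that] unfolding smooth_def nth_deriv_Suc by (simp add: vector_derivative_works)
    then show ?case
      unfolding unif_diff.simps using lb[of j] Suc.IH[of "Suc j"]
      by (intro conjI exI[of _ "\<lambda>h. nth_deriv (Suc j) (V h)"]) auto
  qed
  from this[of _ 0] show ?thesis
    by (simp add: unif_smooth_def nth_deriv_0)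
qed

lemma unif_smooth_affine:
  assumes "unif_smooth P UNIV g"
  shows "unif_smooth P UNIV (\<lambda>h x. g h (c * x + d))"
proof -
  have lb: "locally_bounded P UNIV (\<lambda>h x. f h (c * x + d))" if f: "locally_bounded P UNIV f" for f
    unfolding locally_bounded_def
  proof (intro allI impI)
    fix K :: "real set" assume "compact K \<and> K \<subseteq> UNIV"
    then have "compact ((\<lambda>x. c * x + d) ` K)"
      by (auto intro!: compact_continuous_image continuous_intros)
    then obtain B where "\<And>h y. h \<in> P \<Longrightarrow> y \<in> (\<lambda>x. c * x + d) ` K \<Longrightarrow> cmod (f h y) \<le> B"
      using locally_boundedD[OF f _ subset_UNIV] by blast
    then show "\<exists>B. \<forall>h\<in>P. \<forall>x\<in>K. cmod (f h (c * x + d)) \<le> B"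
      by (intro exI[of _ B]) auto
  qed
  have "unif_diff k P UNIV (\<lambda>h x. f h (c * x + d))" if "unif_diff k P UNIV f" for k f
    using that
  proof (induction k arbitrary: f)
    case 0
    then show ?case using lb by simp
  next
    case (Suc k)
    from Suc.prems obtain f' where f': "\<And>h x. h \<in> P \<Longrightarrow> (f h has_vector_derivative f' h x) (at x)"
      "unif_diff k P UNIV f'"
      unfolding unif_diff.simps by blast
    have "unif_diff k P UNIV (\<lambda>h x. of_real c * f' h (c * x + d))"
      by (rule unif_diff_mult[OF unif_diff_const_in_x[where B = "\<bar>c\<bar>"] Suc.IH[OF f'(2)]]) simp
    moreover have "((\<lambda>x. f h (c * x + d)) has_vector_derivative of_real c * f' h (c * x + d)) (at x)"
      if "h \<in> P" for h x
    proof -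
      have "((\<lambda>x. c * x + d) has_vector_derivative c) (at x)"
        by (auto intro!: derivative_eq_intros simp: has_real_derivative_iff_has_vector_derivative[symmetric])
      from vector_diff_chain_at[OF this f'(1)[OF that]] show ?thesis
        by (simp add: o_def scaleR_conv_of_real)
    qed
    ultimately show ?case
      unfolding unif_diff.simps using lb[OF unif_diff_locally_bounded[OF Suc.prems]]
      by (intro conjI exI[of _ "\<lambda>h x. of_real c * f' h (c * x + d)"]) auto
  qed
  then show ?thesis
    using assms by (simp add: unif_smooth_def)
qed

lemma unif_smooth_inverse:
  assumes g: "unif_smooth P S g" and S: "open S"
    and nz: "\<And>h x. h \<in> P \<Longrightarrow> x \<in> S \<Longrightarrow> g h x \<noteq> 0"
    and lb: "locally_bounded P S (\<lambda>h x. inverse (g h x))"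
  shows "unif_smooth P S (\<lambda>h x. inverse (g h x))"
proof (rule unif_smooth_bootstrap[OF lb])
  let ?y = "\<lambda>h x. inverse (g h x)"
  show "(?y h has_vector_derivative (- dx g h x) * (?y h x * ?y h x)) (at x)" if "h \<in> P" "x \<in> S" for h x
    using field_vector_diff_chain_at[OF unif_smooth_has_dx[OF g that] DERIV_inverse[OF nz[OF that]]]
    by (simp add: o_def power2_eq_square)
  show "unif_diff k P S (\<lambda>h x. (- dx g h x) * (?y h x * ?y h x))" if "unif_diff k P S ?y" for k
    using unif_smooth_minus[OF unif_smooth_dx[OF g S]] that
    by (intro unif_diff_mult) (auto simp: unif_smooth_def)
qed

text \<open>
  The lower bound on the real part keeps the argument off the branch cut and away from zero. The
  regularity of \<open>1 / s\<close>, where \<open>s\<close> is the square root of \<open>g\<close>, comes first, from \<open>(1/s)' = - g' (1/s)^3 / 2\<close>; then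
  \<open>s' = g' (1/s) / 2\<close> handles \<open>s\<close>.
\<close>
lemma unif_smooth_csqrt:
  assumes g: "unif_smooth P S g" and S: "open S" and "c > 0"
    and re: "\<And>h x. h \<in> P \<Longrightarrow> x \<in> S \<Longrightarrow> Re (g h x) \<ge> c"
  shows "unif_smooth P S (\<lambda>h x. csqrt (g h x))"
    and "unif_smooth P S (\<lambda>h x. inverse (csqrt (g h x)))"
    and "\<And>h x. h \<in> P \<Longrightarrow> x \<in> S \<Longrightarrow>
      ((\<lambda>x. csqrt (g h x)) has_vector_derivative dx g h x * inverse (2 * csqrt (g h x))) (at x)"
proof -
  let ?s = "\<lambda>h x. csqrt (g h x)"
  let ?y = "\<lambda>h x. inverse (csqrt (g h x))"
  have nz: "g h x \<noteq> 0" if "h \<in> P" "x \<in> S" for h x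
    using re[OF that] \<open>c > 0\<close> by auto
  show der: "(?s h has_vector_derivative dx g h x * inverse (2 * ?s h x)) (at x)" if "h \<in> P" "x \<in> S" for h x
  proof -
    have "g h x \<notin> \<real>\<^sub>\<le>\<^sub>0" using re[OF that] \<open>c > 0\<close> by (auto simp: complex_nonpos_Reals_iff)
    then show ?thesis
      using field_vector_diff_chain_at[OF unif_smooth_has_dx[OF g that] has_field_derivative_csqrt]
      by (simp add: o_def)
  qed
  have lby: "locally_bounded P S ?y"
  proof -
    have "cmod (?y h x) \<le> 1 / sqrt c" if "h \<in> P" "x \<in> S" for h x
    proof -
      have "sqrt c \<le> cmod (?s h x)"
        using re[OF that] abs_Re_le_cmod[of "g h x"] by (simp add: norm_csqrt)
      then show ?thesis using \<open>c > 0\<close>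
        by (simp add: norm_divide inverse_eq_divide frac_le)
    qed
    then show ?thesis unfolding locally_bounded_def by blast
  qed
  have lbs: "locally_bounded P S ?s"
    unfolding locally_bounded_def
  proof (intro allI impI)
    fix K assume K: "compact K \<and> K \<subseteq> S"
    obtain B where "\<And>h x. h \<in> P \<Longrightarrow> x \<in> K \<Longrightarrow> cmod (g h x) \<le> B"
      using locally_boundedD[OF unif_smooth_locally_bounded[OF g]] K by metis
    then show "\<exists>B. \<forall>h\<in>P. \<forall>x\<in>K. cmod (?s h x) \<le> B"
      by (intro exI[of _ "sqrt B"]) (auto simp: norm_csqrt)
  qed
  have dg: "unif_smooth P S (dx g)" using g S by (rule unif_smooth_dx)
  have der_y: "(?y h has_vector_derivative - dx g h x * inverse 2 * (?y h x * (?y h x * ?y h x))) (at x)"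
    if "h \<in> P" "x \<in> S" for h x
    using field_vector_diff_chain_at[OF der[OF that] DERIV_inverse] nz[OF that]
    by (simp add: o_def power2_eq_square mult_ac)
  show y: "unif_smooth P S ?y"
  proof (rule unif_smooth_bootstrap[OF lby der_y])
    fix k assume k: "unif_diff k P S ?y"
    have "unif_smooth P S (\<lambda>h x. - dx g h x * inverse 2)"
      by (intro unif_smooth_mult unif_smooth_minus unif_smooth_const dg)
    then have "unif_diff k P S (\<lambda>h x. - dx g h x * inverse 2)"
      by (simp only: unif_smooth_def)
    then show "unif_diff k P S (\<lambda>h x. - dx g h x * inverse 2 * (?y h x * (?y h x * ?y h x)))"
      by (intro unif_diff_mult[OF _ unif_diff_mult[OF k unif_diff_mult[OF k k]]])
  qed
  show "unif_smooth P S ?s"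
  proof (rule unif_smooth_bootstrap[OF lbs der])
    fix k
    have "unif_smooth P S (\<lambda>h x. dx g h x * (inverse 2 * ?y h x))"
      by (intro unif_smooth_mult unif_smooth_const dg y)
    then show "unif_diff k P S (\<lambda>h x. dx g h x * inverse (2 * ?s h x))"
      by (simp add: unif_smooth_def)
  qed
qed

lemma unif_smooth_exp:
  assumes g: "unif_smooth P S g" and S: "open S"
  shows "unif_smooth P S (\<lambda>h x. exp (g h x))"
proof (rule unif_smooth_bootstrap)
  show "locally_bounded P S (\<lambda>h x. exp (g h x))"
    unfolding locally_bounded_def
  proof (intro allI impI)
    fix K assume K: "compact K \<and> K \<subseteq> S"
    obtain B where "\<And>h x. h \<in> P \<Longrightarrow> x \<in> K \<Longrightarrow> cmod (g h x) \<le> B"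
      using locally_boundedD[OF unif_smooth_locally_bounded[OF g]] K by metis
    then show "\<exists>B. \<forall>h\<in>P. \<forall>x\<in>K. cmod (exp (g h x)) \<le> B"
      by (intro exI[of _ "exp B"]) (auto intro: order.trans[OF complex_Re_le_cmod])
  qed
  show "((\<lambda>x. exp (g h x)) has_vector_derivative dx g h x * exp (g h x)) (at x)"
    if "h \<in> P" "x \<in> S" for h x
    using field_vector_diff_chain_at[OF unif_smooth_has_dx[OF g that] DERIV_exp]
    by (simp add: o_def)
  show "unif_diff k P S (\<lambda>h x. dx g h x * exp (g h x))" if "unif_diff k P S (\<lambda>h x. exp (g h x))" for k
    using unif_smooth_dx[OF g S] that by (intro unif_diff_mult) (auto simp: unif_smooth_def)
qed

section \<open>Approximate solutions of the Riccati equation\<close>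

text \<open>
  The exact equation for \<open>v\<close> is \<open>v^2 + h v' = w^2\<close>. If \<open>v\<close> has residual \<open>h^(k+1) r\<close>, then replacing \<open>v\<close> by
  \<open>v - h^(k+1) s\<close> changes the residual by \<open>- 2 v h^(k+1) s\<close> up to terms with an additional factor
  \<open>h\<close>, and \<open>v = w + O(h)\<close>. Hence \<open>s = r / (2 w)\<close> cancels the leading term. Only derivatives and
  division by \<open>w\<close> occur, so no differential equation is solved and the algebra of uniformly
  smooth families is never left.
\<close>
lemma riccati_approx:
  fixes P :: "real set"
  assumes S: "open S" and P: "P \<subseteq> {0<..1}"
    and w: "unif_smooth P S w" and iw: "unif_smooth P S (\<lambda>h x. inverse (w h x))"
    and nz: "\<And>h x. h \<in> P \<Longrightarrow> x \<in> S \<Longrightarrow> w h x \<noteq> 0"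
  shows "\<exists>q r. unif_smooth P S q \<and> unif_smooth P S r \<and>
    (\<forall>h\<in>P. \<forall>x\<in>S. (w h x + of_real h * q h x)\<^sup>2 + of_real h * (dx w h x + of_real h * dx q h x)
        - (w h x)\<^sup>2 = of_real h ^ Suc k * r h x)"
proof (induction k)
  case 0
  show ?case
    by (rule exI[of _ "\<lambda>h x. 0"], rule exI[of _ "dx w"])
      (auto simp: unif_smooth_const unif_smooth_dx w S)
next
  case (Suc k)
  then obtain q r where q: "unif_smooth P S q" and r: "unif_smooth P S r"
    and eq: "\<And>h x. h \<in> P \<Longrightarrow> x \<in> S \<Longrightarrow>
      (w h x + of_real h * q h x)\<^sup>2 + of_real h * (dx w h x + of_real h * dx q h x)
        - (w h x)\<^sup>2 = of_real h ^ Suc k * r h x" by blast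
  \<comment> \<open>The current \<open>v\<close> is \<open>w + h q\<close>, so subtracting \<open>h^(k+1) s\<close> from it means subtracting \<open>h^k s\<close> from \<open>q\<close>.\<close>
  define s where "s = (\<lambda>h x. r h x * (inverse 2 * inverse (w h x)))"
  have s: "unif_smooth P S s"
    unfolding s_def by (intro unif_smooth_mult unif_smooth_const r iw)
  have hk: "unif_smooth P S (\<lambda>h x. of_real h ^ j)" for j
    by (rule unif_smooth_const_in_x[where B = 1]) (use P in \<open>auto simp: norm_power power_le_one\<close>)
  define q2 where "q2 = (\<lambda>h x. q h x - of_real h ^ k * s h x)"
  have q2: "unif_smooth P S q2"
    unfolding q2_def by (intro unif_smooth_diff unif_smooth_mult q s hk)
  have dq2: "dx q2 h x = dx q h x - of_real h ^ k * dx s h x" if "h \<in> P" "x \<in> S" for h x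
  proof (rule vector_derivative_at)
    have "((\<lambda>x. of_real h ^ k * s h x) has_vector_derivative of_real h ^ k * dx s h x) (at x)"
      by (rule has_vector_derivative_mult_right) (rule unif_smooth_has_dx[OF s that])
    then show "(q2 h has_vector_derivative dx q h x - of_real h ^ k * dx s h x) (at x)"
      unfolding q2_def by (intro has_vector_derivative_diff unif_smooth_has_dx[OF q that])
  qed
  define r2 where "r2 = (\<lambda>h x. of_real h ^ k * (s h x * s h x) - 2 * (q h x * s h x) - dx s h x)"
  have r2: "unif_smooth P S r2"
    unfolding r2_def by (intro unif_smooth_diff unif_smooth_mult unif_smooth_const hk s q unif_smooth_dx[OF s S])
  have "(w h x + of_real h * q2 h x)\<^sup>2 + of_real h * (dx w h x + of_real h * dx q2 h x)
        - (w h x)\<^sup>2 = of_real h ^ Suc (Suc k) * r2 h x" if hx: "h \<in> P" "x \<in> S" for h x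
  proof -
    have rs: "r h x = 2 * w h x * s h x"
      using nz[OF hx] by (simp add: s_def)
    have "(w h x + of_real h * q2 h x)\<^sup>2 + of_real h * (dx w h x + of_real h * dx q2 h x) - (w h x)\<^sup>2
      = ((w h x + of_real h * q h x)\<^sup>2 + of_real h * (dx w h x + of_real h * dx q h x) - (w h x)\<^sup>2)
        - of_real h ^ Suc k * (2 * w h x * s h x) + of_real h ^ Suc (Suc k) * r2 h x"
      unfolding dq2[OF hx] unfolding q2_def r2_def
      by (simp add: power2_eq_square algebra_simps)
    then show ?thesis
      using eq[OF hx] rs by simp
  qed
  then show ?case using q2 r2 by blast
qed

section \<open>A smooth cutoff function\<close>

text \<open>
  The functions \<open>x^(-m) exp (-1/x)\<close>, extended by zero to \<open>x \<le> 0\<close>. Keeping the exponent \<open>m\<close> as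
  a parameter makes the class closed under differentiation, up to linear combinations.
\<close>
definition flat :: "nat \<Rightarrow> real \<Rightarrow> complex" where
  "flat m x = (if x > 0 then of_real (inverse x ^ m * exp (- inverse x)) else 0)"

lemma flat_has_derivative:
  "(flat m has_vector_derivative (flat (m + 2) x - of_nat m * flat (m + 1) x)) (at x)"
proof -
  consider "x > 0" | "x < 0" | "x = 0" by linarith
  then show ?thesis
  proof cases
    assume x: "x > 0"
    have "((\<lambda>x. inverse x ^ m * exp (- inverse x)) has_real_derivative
       (inverse x ^ (m + 2) * exp (- inverse x) - m * (inverse x ^ (m + 1) * exp (- inverse x)))) (at x)"
    proof -
      have "((\<lambda>x. inverse x ^ m * exp (- inverse x)) has_real_derivative
         (real m * (- (inverse x * inverse x) * inverse x ^ (m - 1)) * exp (- inverse x)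
          + (exp (- inverse x) * (inverse x * inverse x)) * inverse x ^ m)) (at x)"
        using x by (intro DERIV_mult' DERIV_mult DERIV_power[where n = m, unfolded One_nat_def[symmetric]])
          (auto intro!: derivative_eq_intros)
      moreover have "real m * (- (inverse x * inverse x) * inverse x ^ (m - 1)) = - real m * inverse x ^ (m + 1)"
        by (cases m) (simp_all add: algebra_simps)
      then have "real m * (- (inverse x * inverse x) * inverse x ^ (m - 1)) * exp (- inverse x)
          + (exp (- inverse x) * (inverse x * inverse x)) * inverse x ^ m
        = inverse x ^ (m + 2) * exp (- inverse x) - m * (inverse x ^ (m + 1) * exp (- inverse x))"
        by (simp only: power_add power2_eq_square) (simp add: algebra_simps)
      ultimately show ?thesis by (simp only:)
    qed
    then have "((\<lambda>x. complex_of_real (inverse x ^ m * exp (- inverse x))) has_vector_derivative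
       of_real (inverse x ^ (m + 2) * exp (- inverse x) - m * (inverse x ^ (m + 1) * exp (- inverse x)))) (at x)"
      by (rule has_vector_derivative_of_real)
    then have "(flat m has_vector_derivative
       of_real (inverse x ^ (m + 2) * exp (- inverse x) - m * (inverse x ^ (m + 1) * exp (- inverse x)))) (at x)"
      by (rule has_vector_derivative_transform_within_open[where S = "{0<..}"])
        (use x in \<open>auto simp: flat_def\<close>)
    then show ?thesis using x by (simp add: flat_def)
  next
    assume x: "x < 0"
    have "((\<lambda>_. 0) has_vector_derivative 0) (at x)" by simp
    then have "(flat m has_vector_derivative 0) (at x)"
      by (rule has_vector_derivative_transform_within_open[where S = "{..<0}"])
        (use x in \<open>auto simp: flat_def\<close>)
    then show ?thesis using x by (simp add: flat_def)
  next
    assume x: "x = 0"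
    have lim: "((\<lambda>y. inverse y ^ (m + 1) * exp (- inverse y)) \<longlongrightarrow> 0) (at_right (0::real))"
    proof -
      \<comment> \<open>For \<open>y > 0\<close> the difference quotient at \<open>0\<close> is the function with exponent \<open>m + 1\<close>, which is \<open>t^(m+1) exp (-t)\<close> at \<open>t = 1/y\<close>.\<close>
      have "((\<lambda>t. t ^ (m + 1) / exp t) \<longlongrightarrow> (0::real)) at_top"
        by (rule tendsto_power_div_exp_0)
      then have "((\<lambda>y. inverse y ^ (m + 1) / exp (inverse y)) \<longlongrightarrow> (0::real)) (at_right 0)"
        by (rule filterlim_compose[OF _ filterlim_inverse_at_top_right])
      then show ?thesis by (simp add: exp_minus divide_inverse)
    qed
    have "((\<lambda>y. flat m y /\<^sub>R y) \<longlongrightarrow> 0) (at 0)"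
    proof (rule filterlim_split_at)
      show "((\<lambda>y. flat m y /\<^sub>R y) \<longlongrightarrow> 0) (at_left 0)"
        by (rule tendsto_eventually) (auto simp: flat_def eventually_at_filter)
      have "((\<lambda>y. complex_of_real (inverse y ^ (m + 1) * exp (- inverse y))) \<longlongrightarrow> of_real 0) (at_right 0)"
        by (rule tendsto_of_real[OF lim])
      moreover have "\<forall>\<^sub>F y in at_right 0. complex_of_real (inverse y ^ (m + 1) * exp (- inverse y)) = flat m y /\<^sub>R y"
        by (auto simp: flat_def eventually_at_filter scaleR_conv_of_real)
      ultimately show "((\<lambda>y. flat m y /\<^sub>R y) \<longlongrightarrow> 0) (at_right 0)"
        by (simp add: tendsto_cong)
    qed
    from tendsto_norm_zero[OF this] have "((\<lambda>y. cmod (flat m y) / \<bar>y\<bar>) \<longlongrightarrow> 0) (at 0)"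
      by (simp add: divide_inverse_commute)
    then have "(flat m has_vector_derivative 0) (at 0)"
      by (simp add: has_vector_derivative_def has_derivative_at flat_def[of m 0])
    then show ?thesis using x by (simp add: flat_def)
  qed
qed

lemma unif_smooth_flat: "unif_smooth P S (\<lambda>_. flat m)"
proof -
  have cont: "continuous_on S (flat m)" for m
    using flat_has_derivative
    by (meson continuous_at_imp_continuous_on has_vector_derivative_continuous)
  have "unif_diff k P S (\<lambda>_. flat m)" for k
  proof (induction k arbitrary: m)
    case 0
    then show ?case using locally_bounded_single[OF cont] by simp
  next
    case (Suc k)
    have "unif_diff k P S (\<lambda>_ x. - of_nat m * flat (m + 1) x)"
      by (intro unif_diff_mult Suc.IH unif_diff_const_in_x[where B = "cmod (- of_nat m)"]) simp
    then have "unif_diff k P S (\<lambda>_ x. flat (m + 2) x + - of_nat m * flat (m + 1) x)"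
      by (intro unif_diff_add Suc.IH)
    then show ?case
      using locally_bounded_single[OF cont] flat_has_derivative
      by (auto intro!: exI[of _ "\<lambda>_ x. flat (m + 2) x - of_nat m * flat (m + 1) x"])
  qed
  then show ?thesis by (simp add: unif_smooth_def)
qed

text \<open>
  The standard transition function: the denominator never vanishes because \<open>x\<close> or \<open>1 - x\<close> is
  positive.
\<close>
definition smooth_step :: "real \<Rightarrow> complex" where
  "smooth_step x = flat 0 x * inverse (flat 0 x + flat 0 (1 - x))"

lemma smooth_step_zero: "x \<le> 0 \<Longrightarrow> smooth_step x = 0"
  by (simp add: smooth_step_def flat_def)

lemma smooth_step_one: "x \<ge> 1 \<Longrightarrow> smooth_step x = 1"
  by (simp add: smooth_step_def flat_def)

lemma unif_smooth_smooth_step: "unif_smooth P UNIV (\<lambda>_. smooth_step)"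
proof -
  let ?d = "\<lambda>x. flat 0 x + flat 0 (1 - x)"
  have d: "unif_smooth P UNIV (\<lambda>_. ?d)" for P :: "'i set"
    using unif_smooth_add[OF unif_smooth_flat[of P UNIV 0] unif_smooth_affine[OF unif_smooth_flat[of P UNIV 0], of "-1" 1]]
    by simp
  have nz: "?d x \<noteq> 0" for x
  proof -
    have pos: "Re (flat 0 y) \<ge> 0" "y > 0 \<Longrightarrow> Re (flat 0 y) > 0" for y
      by (auto simp: flat_def)
    have "x > 0 \<or> 1 - x > 0" by linarith
    then have "Re (?d x) > 0"
      using pos(1)[of x] pos(1)[of "1 - x"] pos(2)[of x] pos(2)[of "1 - x"]
      by (auto simp: add_pos_nonneg add_nonneg_pos)
    then show ?thesis by (metis less_irrefl zero_complex.sel(1))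
  qed
  have "continuous_on UNIV ?d"
    using unif_smooth_continuous[OF d[of "{undefined}"]] by simp
  then have "continuous_on UNIV (\<lambda>x. inverse (?d x))"
    by (intro continuous_on_inverse ballI nz)
  then have "unif_smooth P UNIV (\<lambda>_ x. inverse (?d x))"
    by (intro unif_smooth_inverse[OF d open_UNIV nz] locally_bounded_single)
  then have "unif_smooth P UNIV (\<lambda>_ x. flat 0 x * inverse (?d x))"
    by (intro unif_smooth_mult unif_smooth_flat)
  then show ?thesis
    unfolding smooth_step_def by simp
qed

lemma plateau_exists:
  fixes a \<rho> :: real
  assumes "\<rho> > 0"
  obtains \<theta> where "unif_smooth {()} UNIV (\<lambda>_. \<theta>)"
    "\<And>x. \<bar>x - a\<bar> \<le> \<rho> \<Longrightarrow> \<theta> x = 1" "\<And>x. \<bar>x - a\<bar> \<ge> 2 * \<rho> \<Longrightarrow> \<theta> x = 0"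
proof
  let ?cut = "\<lambda>x. smooth_step (1/\<rho> * x + (2 - a/\<rho>)) * smooth_step (- 1/\<rho> * x + (2 + a/\<rho>))"
  show "unif_smooth {()} UNIV (\<lambda>_. ?cut)"
    by (rule unif_smooth_mult[OF unif_smooth_affine[OF unif_smooth_smooth_step] unif_smooth_affine[OF unif_smooth_smooth_step]])
  have arg: "1/\<rho> * x + (2 - a/\<rho>) = 2 + (x - a) / \<rho>" "- 1/\<rho> * x + (2 + a/\<rho>) = 2 - (x - a) / \<rho>" for x
    using assms by (simp_all add: diff_divide_distrib)
  show "?cut x = 1" if "\<bar>x - a\<bar> \<le> \<rho>" for x
  proof -
    have "\<bar>(x - a) / \<rho>\<bar> \<le> 1"
      using that assms by simp
    then have "1 \<le> 2 + (x - a) / \<rho>" "1 \<le> 2 - (x - a) / \<rho>"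
      by linarith+
    then show ?thesis
      unfolding arg by (simp add: smooth_step_one)
  qed
  show "?cut x = 0" if "\<bar>x - a\<bar> \<ge> 2 * \<rho>" for x
  proof -
    have "\<bar>(x - a) / \<rho>\<bar> \<ge> 2"
      using that assms by (simp add: pos_le_divide_eq)
    then have "2 + (x - a) / \<rho> \<le> 0 \<or> 2 - (x - a) / \<rho> \<le> 0"
      by linarith
    then show ?thesis
      unfolding arg using smooth_step_zero by auto
  qed
qed

section \<open>The phase\<close>

lemma has_real_derivative_Re:
  assumes "(f has_vector_derivative f') (at x)"
  shows "((\<lambda>x. Re (f x)) has_real_derivative Re f') (at x)"
  using bounded_linear.has_vector_derivative[OF bounded_linear_Re assms]
  by (simp add: has_real_derivative_iff_has_vector_derivative)

text \<open>
  At \<open>a\<close> the leading term \<open>w\<close> of the logarithmic derivative is purely imaginary; the sign of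
  \<open>Re w'\<close> makes its real part restoring on both sides, which is the source of the localization at \<open>a\<close>.
\<close>
lemma Re_phase_derivative_sign:
  fixes w w' :: "real \<Rightarrow> complex" and a r c :: real
  assumes der: "\<And>x. \<bar>x - a\<bar> < r \<Longrightarrow> (w has_vector_derivative w' x) (at x)"
    and neg: "\<And>x. \<bar>x - a\<bar> < r \<Longrightarrow> Re (w' x) \<le> - 2 * c"
    and "Re (w a) = 0" and x: "\<bar>x - a\<bar> < r"
  shows "a \<le> x \<Longrightarrow> Re (w x) \<le> - 2 * c * (x - a)" and "x \<le> a \<Longrightarrow> - 2 * c * (x - a) \<le> Re (w x)"
proof -
  let ?G = "\<lambda>t. Re (w t) + 2 * c * (t - a)"
  have "\<exists>y. (?G has_real_derivative y) (at t) \<and> y \<le> 0" if "\<bar>t - a\<bar> < r" for t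
  proof (intro exI conjI)
    show "(?G has_real_derivative (Re (w' t) + 2 * c)) (at t)"
      by (auto intro!: derivative_eq_intros has_real_derivative_Re der that)
    show "Re (w' t) + 2 * c \<le> 0" using neg[OF that] by simp
  qed
  note mono = DERIV_nonpos_imp_nonincreasing[where f = ?G, OF _ this]
  show "Re (w x) \<le> - 2 * c * (x - a)" if "a \<le> x"
  proof -
    have "?G x \<le> ?G a"
      by (rule mono[OF that]) (use x in auto)
    then show ?thesis using \<open>Re (w a) = 0\<close> by simp
  qed
  show "- 2 * c * (x - a) \<le> Re (w x)" if "x \<le> a"
  proof -
    have "?G a \<le> ?G x"
      by (rule mono[OF that]) (use x in auto)
    then show ?thesis using \<open>Re (w a) = 0\<close> by simp
  qed
qed

text \<open>
  For \<open>c > 0\<close> this is Gaussian decay of the exponential of \<open>\<Phi> / h\<close> away from \<open>a\<close>. The correction to \<open>w\<close> is \<open>O(h)\<close>, hence costs only the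
  term \<open>C h |x - a|\<close>, which after division by \<open>h\<close> contributes a bounded factor.
\<close>
lemma phase_bounds:
  fixes a c C h \<rho> :: real and \<Phi> v :: "real \<Rightarrow> complex"
  assumes der: "\<And>x. \<bar>x - a\<bar> \<le> 2 * \<rho> \<Longrightarrow> (\<Phi> has_vector_derivative v x) (at x)"
    and "\<Phi> a = 0"
    and right: "\<And>x. a \<le> x \<Longrightarrow> x \<le> a + 2 * \<rho> \<Longrightarrow> Re (v x) \<le> - 2 * c * (x - a) + C * h"
    and left: "\<And>x. a - 2 * \<rho> \<le> x \<Longrightarrow> x \<le> a \<Longrightarrow> - 2 * c * (x - a) - C * h \<le> Re (v x)"
    and x: "\<bar>x - a\<bar> \<le> 2 * \<rho>"
  shows "Re (\<Phi> x) \<le> - c * (x - a)\<^sup>2 + C * h * \<bar>x - a\<bar>"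
proof (cases "a \<le> x")
  case True
  let ?G = "\<lambda>t. Re (\<Phi> t) + c * (t - a)\<^sup>2 - C * h * (t - a)"
  have "?G x \<le> ?G a"
  proof (rule DERIV_nonpos_imp_nonincreasing[where f = ?G, OF True])
    fix t assume t: "a \<le> t" "t \<le> x"
    then have "(?G has_real_derivative (Re (v t) + 2 * c * (t - a) - C * h)) (at t)"
      using x by (auto intro!: derivative_eq_intros has_real_derivative_Re der)
    moreover have "Re (v t) + 2 * c * (t - a) - C * h \<le> 0"
      using right[of t] t x by auto
    ultimately show "\<exists>y. (?G has_real_derivative y) (at t) \<and> y \<le> 0" by blast
  qed
  then show ?thesis using True \<open>\<Phi> a = 0\<close> by simp
next
  case False
  let ?G = "\<lambda>t. Re (\<Phi> t) + c * (t - a)\<^sup>2 + C * h * (t - a)"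
  have "?G x \<le> ?G a"
  proof (rule DERIV_nonneg_imp_nondecreasing[where f = ?G])
    show "x \<le> a" using False by simp
    fix t assume t: "x \<le> t" "t \<le> a"
    then have "(?G has_real_derivative (Re (v t) + 2 * c * (t - a) + C * h)) (at t)"
      using x by (auto intro!: derivative_eq_intros has_real_derivative_Re der)
    moreover have "0 \<le> Re (v t) + 2 * c * (t - a) + C * h"
      using left[of t] t x by auto
    ultimately show "\<exists>y. (?G has_real_derivative y) (at t) \<and> 0 \<le> y" by blast
  qed
  then show ?thesis using False \<open>\<Phi> a = 0\<close> by (simp add: algebra_simps)
qed

lemma wkb_antiderivative:
  fixes a \<rho> :: real and v :: "real \<Rightarrow> complex"
  assumes "\<rho> > 0" and v: "unif_smooth {()} {a - 4 * \<rho><..<a + 4 * \<rho>} (\<lambda>_. v)"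
  obtains \<Phi> where "\<Phi> a = 0" "unif_smooth {()} {a - 3 * \<rho><..<a + 3 * \<rho>} (\<lambda>_. \<Phi>)"
    "\<And>x. x \<in> {a - 3 * \<rho><..<a + 3 * \<rho>} \<Longrightarrow> (\<Phi> has_vector_derivative v x) (at x)"
proof -
  \<comment> \<open>The interval shrinks because \<open>v\<close> need not extend continuously to the endpoints of its domain.\<close>
  have "continuous_on {a - 3 * \<rho>..a + 3 * \<rho>} v"
    by (rule continuous_on_subset[OF unif_smooth_continuous[OF v]]) (use \<open>\<rho> > 0\<close> in auto)
  then obtain g where g: "\<And>x. x \<in> {a - 3 * \<rho>..a + 3 * \<rho>} \<Longrightarrow>
      (g has_vector_derivative v x) (at x within {a - 3 * \<rho>..a + 3 * \<rho>})"
    using antiderivative_continuous by blast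
  have der: "((\<lambda>x. g x - g a) has_vector_derivative v x) (at x)" if "x \<in> {a - 3 * \<rho><..<a + 3 * \<rho>}" for x
  proof -
    have "(g has_vector_derivative v x) (at x)"
      using g[of x] that at_within_Icc_at[of "a - 3 * \<rho>" x "a + 3 * \<rho>"] by simp
    then show ?thesis by (auto intro!: derivative_eq_intros)
  qed
  show thesis
  proof (rule that[OF _ _ der])
    show "unif_smooth {()} {a - 3 * \<rho><..<a + 3 * \<rho>} (\<lambda>_ x. g x - g a)"
    proof (rule unif_smooth_bootstrap)
      show "locally_bounded {()} {a - 3 * \<rho><..<a + 3 * \<rho>} (\<lambda>_ x. g x - g a)"
        using der by (intro locally_bounded_single)
          (meson continuous_at_imp_continuous_on has_vector_derivative_continuous)
      show "unif_diff k {()} {a - 3 * \<rho><..<a + 3 * \<rho>} (\<lambda>_. v)" for k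
        using unif_smooth_subset[OF v, of "{()}" "{a - 3 * \<rho><..<a + 3 * \<rho>}"] \<open>\<rho> > 0\<close>
        by (simp add: unif_smooth_def subset_eq)
    qed (use der in auto)
  qed auto
qed

section \<open>The quasimode for a fixed parameter\<close>

text \<open>
  The function is \<open>f = \<theta> exp (\<Phi> / h)\<close> with \<open>\<Phi>' = v\<close>. Up to sign its error is the Riccati residual times
  \<open>f\<close>, a part that is bounded relative to \<open>|f|\<close>, plus terms from differentiating \<open>\<theta>\<close>. These
  live at distance at least \<open>\<rho>\<close> from \<open>a\<close>, where the exponential is exponentially small in \<open>1 / h\<close>. The
  constants are explicit so that they can be chosen independently of \<open>h\<close>. On the interval
  \<open>{a..a + h}\<close> the phase is at most \<open>C h\<close> in modulus; this crude lower bound loses only powers of \<open>h\<close>.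
\<close>
lemma wkb_quasimode:
  fixes a \<rho> h c C R M :: real and v W \<theta> :: "real \<Rightarrow> complex"
  assumes "\<rho> > 0" "0 < h" "h \<le> 1" "h \<le> \<rho>" "c \<ge> 0" "C \<ge> 0" "M \<ge> 0"
    and v: "unif_smooth {()} {a - 4 * \<rho><..<a + 4 * \<rho>} (\<lambda>_. v)"
    and bnd: "\<And>x. \<bar>x - a\<bar> \<le> 2 * \<rho> \<Longrightarrow> cmod (v x) \<le> C"
    and right: "\<And>x. a \<le> x \<Longrightarrow> x \<le> a + 2 * \<rho> \<Longrightarrow> Re (v x) \<le> - 2 * c * (x - a) + C * h"
    and left: "\<And>x. a - 2 * \<rho> \<le> x \<Longrightarrow> x \<le> a \<Longrightarrow> - 2 * c * (x - a) - C * h \<le> Re (v x)"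
    and res: "\<And>x. \<bar>x - a\<bar> \<le> 2 * \<rho> \<Longrightarrow>
      cmod ((v x)\<^sup>2 + of_real h * vector_derivative v (at x) - W x) \<le> R"
    and \<theta>: "unif_smooth {()} UNIV (\<lambda>_. \<theta>)"
    and \<theta>1: "\<And>x. \<bar>x - a\<bar> \<le> \<rho> \<Longrightarrow> \<theta> x = 1"
    and \<theta>0: "\<And>x. \<bar>x - a\<bar> \<ge> 2 * \<rho> \<Longrightarrow> \<theta> x = 0"
    and M1: "\<And>x. \<bar>x - a\<bar> \<le> 2 * \<rho> \<Longrightarrow> cmod (nth_deriv 1 \<theta> x) \<le> M"
    and M2: "\<And>x. \<bar>x - a\<bar> \<le> 2 * \<rho> \<Longrightarrow> cmod (nth_deriv 2 \<theta> x) \<le> M"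
  obtains f where "f \<in> test_functions"
    "\<And>x. x \<in> {a..a + h} \<Longrightarrow> exp (- C) \<le> cmod (f x)"
    "\<And>x. cmod (- (of_real h)\<^sup>2 * nth_deriv 2 f x + W x * f x) \<le> R * cmod (f x) +
       indicator {a - 2 * \<rho>..a + 2 * \<rho>} x * (M * (1 + 2 * C) * exp (2 * C * \<rho>) * exp (- (c * \<rho>\<^sup>2) / h))"
proof -
  let ?S = "{a - 3 * \<rho><..<a + 3 * \<rho>}"
  obtain \<Phi> where \<Phi>a: "\<Phi> a = 0" and \<Phi>: "unif_smooth {()} ?S (\<lambda>_. \<Phi>)"
    and d\<Phi>: "\<And>x. x \<in> ?S \<Longrightarrow> (\<Phi> has_vector_derivative v x) (at x)"
    using wkb_antiderivative[OF \<open>\<rho> > 0\<close> v] by blast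
  define E where "E = (\<lambda>x. exp (of_real (inverse h) * \<Phi> x))"
  have E: "unif_smooth {()} ?S (\<lambda>_. E)"
    unfolding E_def by (intro unif_smooth_exp unif_smooth_mult unif_smooth_const \<Phi>) auto
  have normE: "cmod (E x) = exp (Re (\<Phi> x) / h)" for x
    by (simp add: E_def divide_inverse mult.commute del: of_real_inverse)
  have dE: "(E has_vector_derivative (v x / of_real h) * E x) (at x)" if "x \<in> ?S" for x
  proof -
    have "((\<lambda>x. of_real (inverse h) * \<Phi> x) has_vector_derivative (v x / of_real h)) (at x)"
      using has_vector_derivative_mult_right[OF d\<Phi>[OF that], of "of_real (inverse h)"]
      by (simp add: divide_inverse mult.commute)
    from field_vector_diff_chain_at[OF this DERIV_exp] show ?thesis
      by (simp add: o_def E_def)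
  qed
  define f where "f = (\<lambda>x. \<theta> x * E x)"
  let ?T = "{x. 2 * \<rho> < \<bar>x - a\<bar>}"
  have openT: "open ?T"
    by (intro open_Collect_less continuous_intros)
  have f0: "f x = 0" if "x \<in> ?T" for x
    using \<theta>0[of x] that by (simp add: f_def)
  have smooth_f: "smooth f"
  proof (rule smooth_locally)
    fix x
    show "\<exists>S. open S \<and> x \<in> S \<and> unif_smooth {()} S (\<lambda>_. f)"
    proof (cases "x \<in> ?S")
      case True
      have "unif_smooth {()} ?S (\<lambda>_. f)"
        unfolding f_def by (intro unif_smooth_mult E unif_smooth_subset[OF \<theta>]) auto
      then show ?thesis using True by (intro exI[of _ ?S]) auto
    next
      case False
      then have "x \<in> ?T" using \<open>\<rho> > 0\<close> by (auto simp: abs_if)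
      moreover have "unif_smooth {()} ?T (\<lambda>_. f)"
        by (rule unif_smooth_cong[OF unif_smooth_const[of _ _ 0] openT]) (rule f0)
      ultimately show ?thesis using openT by blast
    qed
  qed
  have test: "f \<in> test_functions"
  proof -
    have "{x. f x \<noteq> 0} \<subseteq> {a - 2 * \<rho>..a + 2 * \<rho>}"
    proof
      fix x assume "x \<in> {x. f x \<noteq> 0}"
      then have "\<bar>x - a\<bar> \<le> 2 * \<rho>" using f0[of x] by force
      then show "x \<in> {a - 2 * \<rho>..a + 2 * \<rho>}" by (simp add: abs_le_iff)
    qed
    then have "bounded {x. f x \<noteq> 0}"
      using bounded_subset bounded_closed_interval by blast
    then show ?thesis using smooth_f by (simp add: test_functions_def)
  qed
  have lower: "exp (- C) \<le> cmod (f x)" if x: "x \<in> {a..a + h}" for x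
  proof -
    let ?G = "\<lambda>t. Re (\<Phi> t) + C * (t - a)"
    have "?G a \<le> ?G x"
    proof (rule DERIV_nonneg_imp_nondecreasing[where f = ?G])
      show "a \<le> x" using x by simp
      fix t assume t: "a \<le> t" "t \<le> x"
      then have "t \<in> ?S" using x \<open>h \<le> \<rho>\<close> \<open>\<rho> > 0\<close> by auto
      then have "(?G has_real_derivative (Re (v t) + C)) (at t)"
        by (auto intro!: derivative_eq_intros has_real_derivative_Re d\<Phi>)
      moreover have "0 \<le> Re (v t) + C"
        using bnd[of t] abs_Re_le_cmod[of "v t"] t x \<open>h \<le> \<rho>\<close> \<open>\<rho> > 0\<close> by auto
      ultimately show "\<exists>y. (?G has_real_derivative y) (at t) \<and> 0 \<le> y" by blast
    qed
    moreover have "C * (x - a) \<le> C * h"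
      using x \<open>C \<ge> 0\<close> by (intro mult_left_mono) auto
    ultimately have "- C * h \<le> Re (\<Phi> x)"
      using \<Phi>a by simp
    then have "- C \<le> Re (\<Phi> x) / h"
      using \<open>h > 0\<close> by (simp add: pos_le_divide_eq)
    moreover have "\<theta> x = 1"
      using x \<open>h \<le> \<rho>\<close> by (intro \<theta>1) auto
    ultimately show ?thesis
      by (simp add: f_def normE)
  qed
  let ?B = "M * (1 + 2 * C) * exp (2 * C * \<rho>) * exp (- (c * \<rho>\<^sup>2) / h)"
  have residual: "cmod (- (of_real h)\<^sup>2 * nth_deriv 2 f x + W x * f x) \<le> R * cmod (f x) +
       indicator {a - 2 * \<rho>..a + 2 * \<rho>} x * ?B" for x
  proof (cases "x \<in> ?T")
    case True
    have "((\<lambda>_. 0) has_vector_derivative 0) (at y)" for y :: real by simp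
    then have "(f has_vector_derivative 0) (at y)" if "y \<in> ?T" for y
      by (rule has_vector_derivative_transform_within_open[OF _ openT that]) (use f0 in auto)
    then have "nth_deriv 2 f x = 0"
      by (intro nth_deriv_2[OF openT True]) auto
    then show ?thesis
      using f0[OF True] \<open>M \<ge> 0\<close> \<open>C \<ge> 0\<close> by (simp add: indicator_def)
  next
    case False
    then have x: "\<bar>x - a\<bar> \<le> 2 * \<rho>" by simp
    then have xS: "x \<in> ?S" using \<open>\<rho> > 0\<close> by (auto simp: abs_if split: if_splits)
    let ?\<theta>1 = "nth_deriv 1 \<theta>" and ?\<theta>2 = "nth_deriv 2 \<theta>" and ?v' = "\<lambda>x. vector_derivative v (at x)"
    have d\<theta>: "(\<theta> has_vector_derivative ?\<theta>1 y) (at y)" "(?\<theta>1 has_vector_derivative ?\<theta>2 y) (at y)" for y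
      using unif_smooth_has_dx[OF \<theta>, of "()" y] unif_smooth_has_dx[OF unif_smooth_nth_deriv[OF \<theta>, of 1], of "()" y]
      by (simp_all add: nth_deriv_Suc nth_deriv_0 numeral_2_eq_2)
    have dv: "(v has_vector_derivative ?v' x) (at x)"
      using unif_smooth_has_dx[OF v, of "()" x] xS \<open>\<rho> > 0\<close> by auto
    have df: "(f has_vector_derivative (\<theta> y * ((v y / of_real h) * E y) + ?\<theta>1 y * E y)) (at y)" if "y \<in> ?S" for y
      unfolding f_def by (intro has_vector_derivative_mult d\<theta> dE that)
    have dvh: "((\<lambda>x. v x / of_real h) has_vector_derivative ?v' x / of_real h) (at x)"
      using has_vector_derivative_mult_left[OF dv, of "inverse (of_real h)"]
      by (simp add: divide_inverse)
    have f2: "nth_deriv 2 f x =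
      (\<theta> x * ((v x / of_real h) * ((v x / of_real h) * E x) + (?v' x / of_real h) * E x)
         + ?\<theta>1 x * ((v x / of_real h) * E x)) + (?\<theta>1 x * ((v x / of_real h) * E x) + ?\<theta>2 x * E x)"
      by (rule nth_deriv_2[OF open_greaterThanLessThan xS df], assumption)
        (intro has_vector_derivative_add has_vector_derivative_mult d\<theta> dE dvh xS)
    have h0: "complex_of_real h \<noteq> 0" using \<open>h > 0\<close> by simp
    have eq: "- (of_real h)\<^sup>2 * nth_deriv 2 f x + W x * f x =
      - (((v x)\<^sup>2 + of_real h * ?v' x - W x) * f x) - of_real h * (of_real h * ?\<theta>2 x + 2 * ?\<theta>1 x * v x) * E x"
      unfolding f2 unfolding f_def using h0 by (simp add: field_simps power2_eq_square)
    have "cmod (((v x)\<^sup>2 + of_real h * ?v' x - W x) * f x) \<le> R * cmod (f x)"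
      unfolding norm_mult by (intro mult_right_mono res x) auto
    \<comment> \<open>The derivatives of \<open>\<theta>\<close> vanish in the open interval around \<open>a\<close> of radius \<open>\<rho>\<close>; beyond it \<open>E\<close> is small.\<close>
    moreover have "cmod (of_real h * (of_real h * ?\<theta>2 x + 2 * ?\<theta>1 x * v x) * E x) \<le> ?B"
    proof (cases "\<bar>x - a\<bar> < \<rho>")
      case True
      have op: "open {x. \<bar>x - a\<bar> < \<rho>}"
        by (intro open_Collect_less continuous_intros)
      have "((\<lambda>_. 1) has_vector_derivative 0) (at y)" for y :: real by simp
      then have z: "(\<theta> has_vector_derivative 0) (at y)" if "\<bar>y - a\<bar> < \<rho>" for y
        by (rule has_vector_derivative_transform_within_open[OF _ op]) (use \<theta>1 that in auto)
      have "?\<theta>1 x = 0"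
        using vector_derivative_unique_at[OF d\<theta>(1) z[OF True]] .
      moreover have "?\<theta>2 x = 0"
        by (rule nth_deriv_2[OF op _ z]) (use True in auto)
      ultimately show ?thesis using \<open>M \<ge> 0\<close> \<open>C \<ge> 0\<close> by simp
    next
      case far: False
      have "Re (\<Phi> x) \<le> - c * (x - a)\<^sup>2 + C * h * \<bar>x - a\<bar>"
      proof (rule phase_bounds[where \<Phi> = \<Phi> and v = v, OF _ \<Phi>a right left x])
        fix y assume "\<bar>y - a\<bar> \<le> 2 * \<rho>"
        then show "(\<Phi> has_vector_derivative v y) (at y)"
          using \<open>\<rho> > 0\<close> by (intro d\<Phi>) (auto simp: abs_if split: if_splits)
      qed
      also have "\<dots> \<le> - c * \<rho>\<^sup>2 + C * h * (2 * \<rho>)"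
      proof -
        have "\<rho>\<^sup>2 \<le> (x - a)\<^sup>2"
          using far \<open>\<rho> > 0\<close> by (intro abs_le_square_iff[THEN iffD1]) auto
        then have "c * \<rho>\<^sup>2 \<le> c * (x - a)\<^sup>2" using \<open>c \<ge> 0\<close> by (rule mult_left_mono)
        moreover have "C * h * \<bar>x - a\<bar> \<le> C * h * (2 * \<rho>)"
          using x \<open>C \<ge> 0\<close> \<open>h > 0\<close> by (intro mult_left_mono) auto
        ultimately show ?thesis by simp
      qed
      finally have "Re (\<Phi> x) / h \<le> (- c * \<rho>\<^sup>2 + C * h * (2 * \<rho>)) / h"
        using \<open>h > 0\<close> by (simp add: divide_right_mono)
      also have "\<dots> = 2 * C * \<rho> + - (c * \<rho>\<^sup>2) / h"
        using \<open>h > 0\<close> by (simp add: field_simps)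
      finally have Eb: "cmod (E x) \<le> exp (2 * C * \<rho>) * exp (- (c * \<rho>\<^sup>2) / h)"
        by (simp only: normE exp_le_cancel_iff flip: exp_add)
      have "cmod (of_real h * ?\<theta>2 x + 2 * ?\<theta>1 x * v x) \<le> h * M + 2 * M * C"
        using M1[OF x] M2[OF x] bnd[OF x] \<open>h > 0\<close> \<open>M \<ge> 0\<close> \<open>C \<ge> 0\<close>
        by (intro norm_triangle_mono) (auto simp: norm_mult intro!: mult_mono)
      also have "\<dots> \<le> M * (1 + 2 * C)"
        using mult_right_mono[OF \<open>h \<le> 1\<close> \<open>M \<ge> 0\<close>] by (simp add: algebra_simps)
      finally have b: "cmod (of_real h * ?\<theta>2 x + 2 * ?\<theta>1 x * v x) \<le> M * (1 + 2 * C)" .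
      have "cmod (of_real h * (of_real h * ?\<theta>2 x + 2 * ?\<theta>1 x * v x) * E x)
          \<le> (1 * (M * (1 + 2 * C))) * (exp (2 * C * \<rho>) * exp (- (c * \<rho>\<^sup>2) / h))"
        unfolding norm_mult using b Eb \<open>h \<le> 1\<close> \<open>h > 0\<close> \<open>M \<ge> 0\<close> \<open>C \<ge> 0\<close>
        by (intro mult_mono) (auto simp: norm_mult)
      then show ?thesis by (simp add: mult.assoc)
    qed
    moreover have "indicator {a - 2 * \<rho>..a + 2 * \<rho>} x = (1::real)"
      using x by (auto simp: indicator_def abs_if split: if_splits)
    ultimately show ?thesis
      unfolding eq
      by (intro order.trans[OF norm_triangle_ineq4 add_mono]) (simp_all only: norm_minus_cancel mult_1)
  qed
  show thesis
    by (rule that[OF test lower residual])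
qed

section \<open>Uniform estimates for the family of quasimodes\<close>

lemma exp_minus_le_power:
  fixes \<kappa> h :: real
  assumes "\<kappa> > 0" "h > 0" "m > 0"
  shows "exp (- \<kappa> / h) \<le> (real m / \<kappa>) ^ m * h ^ m"
proof -
  define y where "y = \<kappa> / h / real m"
  have y: "y > 0" using assms by (simp add: y_def)
  have "exp (- \<kappa> / h) = exp (- y) ^ m"
    using assms by (simp add: y_def flip: exp_of_nat_mult)
  also have "\<dots> \<le> (inverse y) ^ m"
  proof (rule power_mono)
    have "y \<le> exp y" using exp_ge_add_one_self[of y] by linarith
    then show "exp (- y) \<le> inverse y" using y by (simp add: exp_minus)
  qed simp
  also have "\<dots> = (real m / \<kappa>) ^ m * h ^ m"
    by (simp add: y_def mult.commute flip: power_mult_distrib)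
  finally show ?thesis .
qed

lemma L2_norm_estimate:
  fixes f g :: "real \<Rightarrow> complex"
  assumes f: "square_integrable f" and g: "square_integrable g" and "p \<le> q"
    and le: "\<And>x. cmod (g x) \<le> R * cmod (f x) + indicator {p..q} x * B"
  shows "(norm (abs_L2 g))\<^sup>2 \<le> 2 * R\<^sup>2 * (norm (abs_L2 f))\<^sup>2 + 2 * B\<^sup>2 * (q - p)"
proof -
  have sq: "(norm (abs_L2 u))\<^sup>2 = (\<integral>x. (cmod (u x))\<^sup>2 \<partial>lborel)" if "square_integrable u" for u
    using norm_abs_L2[OF that] by (simp add: integral_nonneg_AE)
  have int: "integrable lborel (\<lambda>x. (cmod (u x))\<^sup>2)" if "square_integrable u" for u
    using that by (simp add: square_integrable_def)
  have ind: "integrable lborel (\<lambda>x. indicator {p..q} x * (2 * B\<^sup>2))"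
    using \<open>p \<le> q\<close> by (intro integrable_mult_left integrable_real_indicator) auto
  have "(cmod (g x))\<^sup>2 \<le> 2 * R\<^sup>2 * (cmod (f x))\<^sup>2 + indicator {p..q} x * (2 * B\<^sup>2)" for x
  proof -
    have "(cmod (g x))\<^sup>2 \<le> (R * cmod (f x) + indicator {p..q} x * B)\<^sup>2"
      using le[of x] by (intro power_mono) auto
    also have "\<dots> \<le> 2 * (R * cmod (f x))\<^sup>2 + 2 * (indicator {p..q} x * B)\<^sup>2"
      using sum_squares_bound[of "R * cmod (f x)" "indicator {p..q} x * B"] by (simp add: power2_sum)
    also have "\<dots> = 2 * R\<^sup>2 * (cmod (f x))\<^sup>2 + indicator {p..q} x * (2 * B\<^sup>2)"
      by (simp add: power_mult_distrib indicator_def)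
    finally show ?thesis .
  qed
  then have "(\<integral>x. (cmod (g x))\<^sup>2 \<partial>lborel) \<le>
      (\<integral>x. 2 * R\<^sup>2 * (cmod (f x))\<^sup>2 + indicator {p..q} x * (2 * B\<^sup>2) \<partial>lborel)"
    by (intro integral_mono Bochner_Integration.integrable_add integrable_mult_right int f g ind)
  also have "\<dots> = 2 * R\<^sup>2 * (\<integral>x. (cmod (f x))\<^sup>2 \<partial>lborel) + (q - p) * (2 * B\<^sup>2)"
    using int[OF f] ind \<open>p \<le> q\<close> by simp
  finally show ?thesis
    by (simp add: sq f g mult_ac)
qed

lemma L2_norm_lower:
  fixes f :: "real \<Rightarrow> complex"
  assumes f: "square_integrable f" and "p \<le> q" "0 \<le> m"
    and le: "\<And>x. x \<in> {p..q} \<Longrightarrow> m \<le> cmod (f x)"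
  shows "m\<^sup>2 * (q - p) \<le> (norm (abs_L2 f))\<^sup>2"
proof -
  have "m\<^sup>2 * (q - p) = (\<integral>x. indicator {p..q} x * m\<^sup>2 \<partial>lborel)"
    using \<open>p \<le> q\<close> by simp
  also have "\<dots> \<le> (\<integral>x. (cmod (f x))\<^sup>2 \<partial>lborel)"
  proof (rule integral_mono)
    show "integrable lborel (\<lambda>x. indicator {p..q} x * m\<^sup>2)"
      using \<open>p \<le> q\<close> by (intro integrable_mult_left integrable_real_indicator) auto
    show "integrable lborel (\<lambda>x. (cmod (f x))\<^sup>2)"
      using f by (simp add: square_integrable_def)
    show "indicator {p..q} x * m\<^sup>2 \<le> (cmod (f x))\<^sup>2" for x
      using le[of x] \<open>0 \<le> m\<close> by (auto simp: indicator_def power_mono)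
  qed
  also have "\<dots> = (norm (abs_L2 f))\<^sup>2"
    using norm_abs_L2[OF f] by (simp add: integral_nonneg_AE)
  finally show ?thesis .
qed

text \<open>
  In the application \<open>G\<close> and \<open>N\<close> are the norms of the error and of the quasimode, and \<open>B\<close> bounds the
  cutoff error. The lower bound on \<open>N\<close> costs at most a factor \<open>h\<close>, which is why \<open>B\<close> is required to be of order
  \<open>n + 1\<close>. The summand \<open>1\<close> under the root keeps the constant positive.
\<close>
lemma quasimode_ratio:
  fixes G N h Br B C \<rho> :: real
  assumes "0 < h" "0 < N" "0 \<le> \<rho>" "0 \<le> G"
    and G: "G\<^sup>2 \<le> 2 * (Br * h ^ n)\<^sup>2 * N\<^sup>2 + 2 * B\<^sup>2 * (4 * \<rho>)"
    and B: "0 \<le> B" "B \<le> B1 * h ^ Suc n" and "h \<le> 1"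
    and N: "(exp (- C))\<^sup>2 * h \<le> N\<^sup>2"
  shows "G \<le> sqrt (2 * Br\<^sup>2 + 8 * \<rho> * B1\<^sup>2 * (exp C)\<^sup>2 + 1) * h ^ n * N"
proof (rule power2_le_imp_le)
  have h: "h \<le> (exp C)\<^sup>2 * N\<^sup>2"
  proof -
    have "(exp C)\<^sup>2 * ((exp (- C))\<^sup>2 * h) \<le> (exp C)\<^sup>2 * N\<^sup>2"
      using N by (intro mult_left_mono) auto
    moreover have "(exp C)\<^sup>2 * ((exp (- C))\<^sup>2 * h) = h"
      by (simp add: exp_minus flip: power_mult_distrib mult.assoc)
    ultimately show ?thesis by simp
  qed
  have "B\<^sup>2 \<le> (B1 * h ^ Suc n)\<^sup>2"
    using B by (intro power_mono) auto
  also have "\<dots> = B1\<^sup>2 * (h ^ n)\<^sup>2 * (h * h)"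
    by (simp add: power_mult_distrib power2_eq_square)
  also have "\<dots> \<le> B1\<^sup>2 * (h ^ n)\<^sup>2 * (1 * ((exp C)\<^sup>2 * N\<^sup>2))"
    using h \<open>h \<le> 1\<close> \<open>0 < h\<close> by (intro mult_left_mono mult_mono) auto
  finally have "8 * \<rho> * B\<^sup>2 \<le> 8 * \<rho> * (B1\<^sup>2 * (h ^ n)\<^sup>2 * (1 * ((exp C)\<^sup>2 * N\<^sup>2)))"
    using \<open>0 \<le> \<rho>\<close> by (intro mult_left_mono) auto
  moreover have "2 * B\<^sup>2 * (4 * \<rho>) = 8 * \<rho> * B\<^sup>2" by simp
  moreover have "0 \<le> (h ^ n)\<^sup>2 * N\<^sup>2" by simp
  ultimately have "G\<^sup>2 \<le> 2 * (Br * h ^ n)\<^sup>2 * N\<^sup>2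
      + 8 * \<rho> * (B1\<^sup>2 * (h ^ n)\<^sup>2 * (1 * ((exp C)\<^sup>2 * N\<^sup>2))) + (h ^ n)\<^sup>2 * N\<^sup>2"
    using G by linarith
  also have "\<dots> = (2 * Br\<^sup>2 + 8 * \<rho> * B1\<^sup>2 * (exp C)\<^sup>2 + 1) * ((h ^ n)\<^sup>2 * N\<^sup>2)"
    by (simp add: power_mult_distrib algebra_simps)
  also have "\<dots> = (sqrt (2 * Br\<^sup>2 + 8 * \<rho> * B1\<^sup>2 * (exp C)\<^sup>2 + 1) * h ^ n * N)\<^sup>2"
    using \<open>0 \<le> \<rho>\<close> by (simp add: power_mult_distrib mult.assoc)
  finally show "G\<^sup>2 \<le> (sqrt (2 * Br\<^sup>2 + 8 * \<rho> * B1\<^sup>2 * (exp C)\<^sup>2 + 1) * h ^ n * N)\<^sup>2" .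
  show "0 \<le> sqrt (2 * Br\<^sup>2 + 8 * \<rho> * B1\<^sup>2 * (exp C)\<^sup>2 + 1) * h ^ n * N"
    using assms by (intro mult_nonneg_nonneg real_sqrt_ge_zero) auto
qed

text \<open>
  The parameter range \<open>\<delta>\<close> and the decay rate \<open>c\<close> are fixed by \<open>w\<close>, before the order \<open>n\<close> is chosen.
  The higher corrections, which do depend on \<open>n\<close>, are \<open>O(h)\<close> and affect only the constant \<open>b\<close>.
\<close>
lemma wkb_quasimode_family:
  fixes a \<rho> \<delta> c :: real and w W :: "real \<Rightarrow> real \<Rightarrow> complex" and n :: nat
  defines "P \<equiv> {0<..<\<delta>}" and "S \<equiv> {a - 4 * \<rho><..<a + 4 * \<rho>}"
  assumes "\<rho> > 0" "\<delta> \<le> 1" "\<delta> \<le> \<rho>" "c > 0" "n > 0"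
    and w: "unif_smooth P S w" and iw: "unif_smooth P S (\<lambda>h x. inverse (w h x))"
    and nz: "\<And>h x. h \<in> P \<Longrightarrow> x \<in> S \<Longrightarrow> w h x \<noteq> 0"
    and eikonal: "\<And>h x. h \<in> P \<Longrightarrow> x \<in> S \<Longrightarrow> (w h x)\<^sup>2 = W h x"
    and smooth: "\<And>h. h \<in> P \<Longrightarrow> smooth (W h)"
    and neg: "\<And>h x. h \<in> P \<Longrightarrow> x \<in> S \<Longrightarrow> Re (dx w h x) \<le> - 2 * c"
    and imag: "\<And>h. h \<in> P \<Longrightarrow> Re (w h a) = 0"
  shows "\<exists>b>0. \<forall>h\<in>P. \<exists>f\<in>test_functions. f \<noteq> (\<lambda>_. 0) \<and>
    norm (abs_L2 (schroedinger h (W h) f)) / norm (abs_L2 f) \<le> b * h ^ n"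
proof -
  let ?K = "{a - 2 * \<rho>..a + 2 * \<rho>}"
  have P: "P \<subseteq> {0<..1}" using \<open>\<delta> \<le> 1\<close> by (auto simp: P_def)
  have K: "compact ?K" "?K \<subseteq> S" using \<open>\<rho> > 0\<close> by (auto simp: S_def)
  have S: "open S" by (simp add: S_def)
  have inK: "x \<in> ?K" if "\<bar>x - a\<bar> \<le> 2 * \<rho>" for x
    using that by (auto simp: abs_le_iff)
  have inS: "x \<in> S" if "\<bar>x - a\<bar> < 4 * \<rho>" for x
    using that by (auto simp: S_def abs_less_iff)
  obtain m where n: "n = Suc m" using \<open>n > 0\<close> gr0_implies_Suc by blast
  obtain q r where q: "unif_smooth P S q" and r: "unif_smooth P S r"
    and eq: "\<And>h x. h \<in> P \<Longrightarrow> x \<in> S \<Longrightarrow>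
      (w h x + of_real h * q h x)\<^sup>2 + of_real h * (dx w h x + of_real h * dx q h x)
        - (w h x)\<^sup>2 = of_real h ^ n * r h x"
    using riccati_approx[OF S P w iw nz, of m] n by blast
  obtain Bw where Bw: "Bw \<ge> 0" "\<And>h x. h \<in> P \<Longrightarrow> x \<in> ?K \<Longrightarrow> cmod (w h x) \<le> Bw"
    using locally_boundedD[OF unif_smooth_locally_bounded[OF w] K] by blast
  obtain Bq where Bq: "Bq \<ge> 0" "\<And>h x. h \<in> P \<Longrightarrow> x \<in> ?K \<Longrightarrow> cmod (q h x) \<le> Bq"
    using locally_boundedD[OF unif_smooth_locally_bounded[OF q] K] by blast
  obtain Br where Br: "Br \<ge> 0" "\<And>h x. h \<in> P \<Longrightarrow> x \<in> ?K \<Longrightarrow> cmod (r h x) \<le> Br"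
    using locally_boundedD[OF unif_smooth_locally_bounded[OF r] K] by blast
  obtain \<theta> where \<theta>: "unif_smooth {()} UNIV (\<lambda>_. \<theta>)"
    and \<theta>1: "\<And>x. \<bar>x - a\<bar> \<le> \<rho> \<Longrightarrow> \<theta> x = 1" and \<theta>0: "\<And>x. \<bar>x - a\<bar> \<ge> 2 * \<rho> \<Longrightarrow> \<theta> x = 0"
    using plateau_exists[OF \<open>\<rho> > 0\<close>, of a] by blast
  have \<theta>lb: "locally_bounded {()} UNIV (\<lambda>_. nth_deriv k \<theta>)" for k
    by (intro unif_smooth_locally_bounded unif_smooth_nth_deriv \<theta> open_UNIV)
  obtain M1 where M1: "M1 \<ge> 0" "\<And>x. x \<in> ?K \<Longrightarrow> cmod (nth_deriv 1 \<theta> x) \<le> M1"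
    using locally_boundedD[OF \<theta>lb[of 1] K(1) subset_UNIV] by (metis singletonI)
  obtain M2 where M2: "M2 \<ge> 0" "\<And>x. x \<in> ?K \<Longrightarrow> cmod (nth_deriv 2 \<theta> x) \<le> M2"
    using locally_boundedD[OF \<theta>lb[of 2] K(1) subset_UNIV] by (metis singletonI)
  define M where "M = M1 + M2"
  define C where "C = Bw + Bq"
  define B0 where "B0 = M * (1 + 2 * C) * exp (2 * C * \<rho>)"
  \<comment> \<open>\<open>B0\<close> is the prefactor of the cutoff error; \<open>B1\<close> results from \<open>exp_minus_le_power\<close> with exponent \<open>n + 1\<close>.\<close>
  define B1 where "B1 = B0 * (real (Suc n) / (c * \<rho>\<^sup>2)) ^ Suc n"
  have nonneg: "0 \<le> M" "0 \<le> C" "0 \<le> B0"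
    using M1 M2 Bw Bq by (auto simp: M_def C_def B0_def)
  let ?b = "sqrt (2 * Br\<^sup>2 + 8 * \<rho> * B1\<^sup>2 * (exp C)\<^sup>2 + 1)"
  have "\<exists>f\<in>test_functions. f \<noteq> (\<lambda>_. 0) \<and>
    norm (abs_L2 (schroedinger h (W h) f)) / norm (abs_L2 f) \<le> ?b * h ^ n" if hP: "h \<in> P" for h
  proof -
    have h: "0 < h" "h \<le> 1" "h \<le> \<rho>"
      using hP \<open>\<delta> \<le> 1\<close> \<open>\<delta> \<le> \<rho>\<close> by (auto simp: P_def)
    let ?v = "\<lambda>x. w h x + of_real h * q h x"
    have v: "unif_smooth {()} S (\<lambda>_. ?v)"
      by (intro unif_smooth_add unif_smooth_mult unif_smooth_const
          unif_smooth_member[OF w hP] unif_smooth_member[OF q hP])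
    have dv: "vector_derivative ?v (at x) = dx w h x + of_real h * dx q h x" if "x \<in> S" for x
      by (intro vector_derivative_at has_vector_derivative_add has_vector_derivative_mult_right
          unif_smooth_has_dx[OF w hP that] unif_smooth_has_dx[OF q hP that])
    have hq: "cmod (of_real h * q h x) \<le> Bq * h" if "x \<in> ?K" for x
      using Bq(2)[OF hP that] h by (simp add: norm_mult mult.commute mult_right_mono)
    have Re_hq: "\<bar>Re (of_real h * q h x)\<bar> \<le> C * h" if "x \<in> ?K" for x
    proof -
      have "\<bar>Re (of_real h * q h x)\<bar> \<le> Bq * h"
        using abs_Re_le_cmod hq[OF that] by (rule order_trans)
      also have "\<dots> \<le> C * h"
        using h Bw(1) by (simp add: C_def mult_right_mono)
      finally show ?thesis .
    qed
    have bnd: "cmod (?v x) \<le> C" if "\<bar>x - a\<bar> \<le> 2 * \<rho>" for x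
    proof -
      have "Bq * h \<le> Bq" using h Bq(1) by (simp add: mult_left_le)
      then show ?thesis
        using Bw(2)[OF hP inK[OF that]] hq[OF inK[OF that]] unfolding C_def
        by (intro norm_triangle_mono) auto
    qed
    note sign = Re_phase_derivative_sign[where w = "w h" and w' = "dx w h" and r = "4 * \<rho>",
        OF unif_smooth_has_dx[OF w hP inS] neg[OF hP inS] imag[OF hP]]
    have right: "Re (?v x) \<le> - 2 * c * (x - a) + C * h" if "a \<le> x" "x \<le> a + 2 * \<rho>" for x
      using sign(1)[of x] Re_hq[of x] that \<open>\<rho> > 0\<close> by auto
    have left: "- 2 * c * (x - a) - C * h \<le> Re (?v x)" if "a - 2 * \<rho> \<le> x" "x \<le> a" for x
      using sign(2)[of x] Re_hq[of x] that \<open>\<rho> > 0\<close> by auto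
    have res: "cmod ((?v x)\<^sup>2 + of_real h * vector_derivative ?v (at x) - W h x) \<le> Br * h ^ n"
      if "\<bar>x - a\<bar> \<le> 2 * \<rho>" for x
    proof -
      have xS: "x \<in> S" using inK[OF that] K by auto
      have "(?v x)\<^sup>2 + of_real h * vector_derivative ?v (at x) - W h x = of_real h ^ n * r h x"
        unfolding dv[OF xS] eikonal[OF hP xS, symmetric] by (rule eq[OF hP xS])
      then show ?thesis
        using Br(2)[OF hP inK[OF that]] h by (simp add: norm_mult norm_power mult.commute mult_right_mono)
    qed
    have M1': "cmod (nth_deriv 1 \<theta> x) \<le> M" if "\<bar>x - a\<bar> \<le> 2 * \<rho>" for x
      using M1(2)[OF inK[OF that]] M2(1) by (simp add: M_def)
    have M2': "cmod (nth_deriv 2 \<theta> x) \<le> M" if "\<bar>x - a\<bar> \<le> 2 * \<rho>" for x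
      using M2(2)[OF inK[OF that]] M1(1) by (simp add: M_def)
    obtain f where f: "f \<in> test_functions"
      and low: "\<And>x. x \<in> {a..a + h} \<Longrightarrow> exp (- C) \<le> cmod (f x)"
      and est: "\<And>x. cmod (- (of_real h)\<^sup>2 * nth_deriv 2 f x + W h x * f x) \<le> Br * h ^ n * cmod (f x) +
       indicator ?K x * (B0 * exp (- (c * \<rho>\<^sup>2) / h))"
      using wkb_quasimode[where v = ?v and W = "W h" and R = "Br * h ^ n" and \<theta> = \<theta>, OF \<open>\<rho> > 0\<close> h
          less_imp_le[OF \<open>c > 0\<close>] nonneg(2,1) v[unfolded S_def] bnd right left res \<theta> \<theta>1 \<theta>0 M1' M2']
      unfolding B0_def by blast
    let ?N = "norm (abs_L2 f)" and ?G = "norm (abs_L2 (schroedinger h (W h) f))"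
    have sqf: "square_integrable f" using f by (rule square_integrable_test_function)
    have G: "?G\<^sup>2 \<le> 2 * (Br * h ^ n)\<^sup>2 * ?N\<^sup>2 + 2 * (B0 * exp (- (c * \<rho>\<^sup>2) / h))\<^sup>2 * (a + 2 * \<rho> - (a - 2 * \<rho>))"
      using \<open>\<rho> > 0\<close> est
      by (intro L2_norm_estimate sqf square_integrable_schroedinger f smooth[OF hP])
        (auto simp: schroedinger_def)
    have N: "(exp (- C))\<^sup>2 * (a + h - a) \<le> ?N\<^sup>2"
      using low h by (intro L2_norm_lower sqf) auto
    have "0 < (exp (- C))\<^sup>2 * h" using h by simp
    then have "?N \<noteq> 0" using N by auto
    then have Npos: "0 < ?N" by simp
    have "exp (- (c * \<rho>\<^sup>2) / h) \<le> (real (Suc n) / (c * \<rho>\<^sup>2)) ^ Suc n * h ^ Suc n"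
      using \<open>c > 0\<close> \<open>\<rho> > 0\<close> h by (intro exp_minus_le_power) auto
    then have B: "B0 * exp (- (c * \<rho>\<^sup>2) / h) \<le> B1 * h ^ Suc n"
      unfolding B1_def mult.assoc using nonneg(3) by (rule mult_left_mono)
    have "?G \<le> ?b * h ^ n * ?N"
    proof (rule quasimode_ratio[OF h(1) Npos _ norm_ge_zero _ _ B h(2)])
      show "?G\<^sup>2 \<le> 2 * (Br * h ^ n)\<^sup>2 * ?N\<^sup>2 + 2 * (B0 * exp (- (c * \<rho>\<^sup>2) / h))\<^sup>2 * (4 * \<rho>)"
        using G by simp
    qed (use N nonneg \<open>\<rho> > 0\<close> in auto)
    then have "?G / ?N \<le> ?b * h ^ n"
      using Npos by (simp add: pos_divide_le_eq)
    moreover have "f \<noteq> (\<lambda>_. 0)"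
      using low[of a] h by auto
    ultimately show ?thesis using f by blast
  qed
  moreover have "0 < ?b"
    using \<open>\<rho> > 0\<close> by (intro real_sqrt_gt_zero add_nonneg_pos) auto
  ultimately show ?thesis by blast
qed

section \<open>Choice of the neighbourhood and conclusion\<close>

text \<open>
  At \<open>h = 0\<close> and \<open>x = a\<close> the square root equals \<open>|\<eta>|\<close>, and the second expression, which is the real part of the derivative of
  \<open>\<i> \<sigma> csqrt (\<eta>^2 + V h a - V h x)\<close>, becomes \<open>\<sigma> Im (V_0'(a)) / (2 |\<eta>|)\<close>. This is negative, and it stays
  negative nearby by joint continuity of \<open>V\<close> and \<open>V'\<close>.
\<close>
lemma phase_neighbourhood:
  fixes h0 a \<eta> \<sigma> :: real and V :: "real \<Rightarrow> real \<Rightarrow> complex"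
  assumes "h0 > 0" "\<eta> \<noteq> 0"
    and cont: "\<And>k. continuous_on ({0..<h0} \<times> UNIV) (\<lambda>(h, x). nth_deriv k (V h) x)"
    and \<sigma>: "\<sigma> * Im (nth_deriv 1 (V 0) a) < 0"
  obtains d c where "d > 0" "c > 0"
    "\<And>h x. 0 < h \<Longrightarrow> h < h0 \<Longrightarrow> h + \<bar>x - a\<bar> < d \<Longrightarrow>
      \<eta>\<^sup>2 / 2 \<le> Re (of_real (\<eta>\<^sup>2) + V h a - V h x) \<and>
      Re (\<i> * of_real \<sigma> * (- nth_deriv 1 (V h) x * inverse (2 * csqrt (of_real (\<eta>\<^sup>2) + V h a - V h x)))) \<le> - 2 * c"
proof -
  let ?F = "at (0, a) within {0..<h0} \<times> UNIV"
  let ?p = "\<lambda>y. of_real (\<eta>\<^sup>2) + V (fst y) a - V (fst y) (snd y)"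
  let ?D = "\<lambda>y. Re (\<i> * of_real \<sigma> * (- nth_deriv 1 (V (fst y)) (snd y) * inverse (2 * csqrt (?p y))))"
  have mem: "(0, a) \<in> {0..<h0} \<times> UNIV" using \<open>h0 > 0\<close> by simp
  have lim: "((\<lambda>y. nth_deriv k (V (fst y)) (snd y)) \<longlongrightarrow> nth_deriv k (V 0) a) ?F" for k
    using bspec[OF cont[of k, unfolded continuous_on_def] mem] by (simp add: case_prod_beta')
  have "continuous_on ({0..<h0} \<times> UNIV) (\<lambda>y. nth_deriv 0 (V (fst y)) a)"
    using continuous_on_compose2[OF cont[of 0], of "{0..<h0} \<times> UNIV" "\<lambda>y. (fst y, a)"]
    by (force intro!: continuous_intros)
  then have "((\<lambda>y. nth_deriv 0 (V (fst y)) a) \<longlongrightarrow> nth_deriv 0 (V 0) a) ?F"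
    using mem unfolding continuous_on_def by auto
  then have limp: "(?p \<longlongrightarrow> of_real (\<eta>\<^sup>2) + V 0 a - V 0 a) ?F"
    using lim[of 0] by (intro tendsto_intros) (simp_all add: nth_deriv_0)
  then have limp: "(?p \<longlongrightarrow> of_real (\<eta>\<^sup>2)) ?F" by simp
  have notneg: "complex_of_real (\<eta>\<^sup>2) \<notin> \<real>\<^sub>\<le>\<^sub>0"
    using \<open>\<eta> \<noteq> 0\<close> by (simp add: complex_nonpos_Reals_iff)
  have cs: "csqrt (of_real (\<eta>\<^sup>2)) = of_real \<bar>\<eta>\<bar>"
    by simp
  have limc: "((\<lambda>y. csqrt (?p y)) \<longlongrightarrow> of_real \<bar>\<eta>\<bar>) ?F"
    using isCont_tendsto_compose[OF continuous_at_csqrt[OF notneg] limp] unfolding cs .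
  define e where "e = - \<sigma> * Im (nth_deriv 1 (V 0) a) / (2 * \<bar>\<eta>\<bar>)"
  have "e > 0" using \<sigma> \<open>\<eta> \<noteq> 0\<close> by (simp add: e_def divide_neg_pos)
  have "(?D \<longlongrightarrow> Re (\<i> * of_real \<sigma> * (- nth_deriv 1 (V 0) a * inverse (2 * of_real \<bar>\<eta>\<bar>)))) ?F"
    using \<open>\<eta> \<noteq> 0\<close> by (intro tendsto_intros lim limc) auto
  moreover have "Re (\<i> * of_real \<sigma> * (- nth_deriv 1 (V 0) a * inverse (2 * of_real \<bar>\<eta>\<bar>))) = - e"
  proof -
    have inv: "inverse (2 * of_real \<bar>\<eta>\<bar>) = complex_of_real (inverse (2 * \<bar>\<eta>\<bar>))" by simp
    have Re: "Re (\<i> * of_real \<sigma> * (- v * of_real r)) = \<sigma> * Im v * r" for v r by simp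
    show ?thesis
      unfolding inv Re e_def by (simp only: divide_inverse mult_minus_left minus_minus)
  qed
  ultimately have limD: "(?D \<longlongrightarrow> - e) ?F" by simp
  \<comment> \<open>The limit is \<open>- e\<close>, so any bound above \<open>- e\<close> holds near the limit point; \<open>c = e / 4\<close> gives \<open>- e / 2\<close>.\<close>
  have "\<forall>\<^sub>F y in ?F. ?D y < - 2 * (e / 4)"
    using \<open>e > 0\<close> by (intro order_tendstoD(2)[OF limD]) simp
  moreover have "\<forall>\<^sub>F y in ?F. \<eta>\<^sup>2 / 2 < Re (?p y)"
    using \<open>\<eta> \<noteq> 0\<close> by (intro order_tendstoD(1)[OF tendsto_Re[OF limp]]) simp
  ultimately have "\<forall>\<^sub>F y in ?F. ?D y < - 2 * (e / 4) \<and> \<eta>\<^sup>2 / 2 < Re (?p y)"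
    by (rule eventually_conj)
  then obtain d where "d > 0" and d: "\<And>y. y \<in> {0..<h0} \<times> UNIV \<Longrightarrow> y \<noteq> (0, a) \<Longrightarrow> dist y (0, a) < d \<Longrightarrow>
      ?D y < - 2 * (e / 4) \<and> \<eta>\<^sup>2 / 2 < Re (?p y)"
    unfolding eventually_at by blast
  show thesis
  proof (rule that[OF \<open>d > 0\<close>, of "e / 4"])
    fix h x :: real assume hx: "0 < h" "h < h0" "h + \<bar>x - a\<bar> < d"
    have "dist (h, x) (0, a) \<le> h + \<bar>x - a\<bar>"
      using sqrt_sum_squares_le_sum_abs[of h "x - a"] hx by (simp add: dist_Pair_Pair dist_real_def)
    then show "\<eta>\<^sup>2 / 2 \<le> Re (of_real (\<eta>\<^sup>2) + V h a - V h x) \<and>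
      Re (\<i> * of_real \<sigma> * (- nth_deriv 1 (V h) x * inverse (2 * csqrt (of_real (\<eta>\<^sup>2) + V h a - V h x)))) \<le> - 2 * (e / 4)"
      using d[of "(h, x)"] hx by (auto intro: less_imp_le)
  qed (use \<open>e > 0\<close> in simp)
qed

lemma closed_extension_minus_scalar:
  assumes "closed_extension (schroedinger h U) D T" and f: "f \<in> test_functions" and "smooth U"
  shows "T (abs_L2 f) - z *\<^sub>C abs_L2 f = abs_L2 (schroedinger h (\<lambda>x. U x - z) f)"
proof -
  have "T (abs_L2 f) = abs_L2 (schroedinger h U f)"
    using assms(1) f by (simp add: closed_extension_def)
  moreover have "L2_rel f f" "L2_rel (\<lambda>x. z * f x) (\<lambda>x. z * f x)"
    "L2_rel (schroedinger h U f) (schroedinger h U f)"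
    using square_integrable_test_function[OF f] square_integrable_schroedinger[OF f \<open>smooth U\<close>]
    by (auto simp: L2_rel_def square_integrable_cmult)
  ultimately have "T (abs_L2 f) - z *\<^sub>C abs_L2 f = abs_L2 (\<lambda>x. schroedinger h U f x - z * f x)"
    by (simp add: scaleC_L2.abs_eq minus_L2.abs_eq)
  also have "(\<lambda>x. schroedinger h U f x - z * f x) = schroedinger h (\<lambda>x. U x - z) f"
    by (simp add: schroedinger_def algebra_simps)
  finally show ?thesis .
qed

theorem theorem1:
  fixes h0 a \<eta> :: real
    and V :: "real \<Rightarrow> real \<Rightarrow> complex"
    and D :: "real \<Rightarrow> L2 set"
    and H :: "real \<Rightarrow> L2 \<Rightarrow> L2"
    and z :: "real \<Rightarrow> complex"
  assumes "h0 > 0"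
    and "\<And>h. 0 \<le> h \<Longrightarrow> h < h0 \<Longrightarrow> smooth (V h)"
    and "\<And>k. continuous_on ({0..<h0} \<times> UNIV) (\<lambda>(h, x). nth_deriv k (V h) x)"
    and "\<And>h. 0 < h \<Longrightarrow> h < h0 \<Longrightarrow> closed_extension (schroedinger h (V h)) (D h) (H h)"
    and "\<eta> \<noteq> 0"
    and "Im (nth_deriv 1 (V 0) a) \<noteq> 0"
    and "\<And>h. z h = of_real (\<eta>\<^sup>2) + V h a"
  shows "\<exists>\<delta>. 0 < \<delta> \<and> \<delta> \<le> h0 \<and>
    (\<forall>n::nat. n > 0 \<longrightarrow>
      (\<exists>c::real. c > 0 \<and>
        (\<exists>f::real \<Rightarrow> real \<Rightarrow> complex. \<forall>h. 0 < h \<and> h < \<delta> \<longrightarrow>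
          f h \<in> test_functions \<and> f h \<noteq> (\<lambda>_. 0) \<and>
          norm (H h (abs_L2 (f h)) - z h *\<^sub>C abs_L2 (f h)) / norm (abs_L2 (f h)) \<le> c * h ^ n)))"
proof -
  \<comment> \<open>The choice of the root: with this sign the real part of the leading phase has a local maximum at \<open>a\<close>.\<close>
  define \<sigma> where "\<sigma> = - sgn (Im (nth_deriv 1 (V 0) a))"
  have \<sigma>: "\<sigma> * Im (nth_deriv 1 (V 0) a) < 0" "\<sigma> * \<sigma> = 1"
    using assms(6) by (auto simp: \<sigma>_def sgn_if)
  let ?p = "\<lambda>h x. of_real (\<eta>\<^sup>2) + V h a - V h x"
  obtain d c where "d > 0" "c > 0" and near: "\<And>h x. 0 < h \<Longrightarrow> h < h0 \<Longrightarrow> h + \<bar>x - a\<bar> < d \<Longrightarrow>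
      \<eta>\<^sup>2 / 2 \<le> Re (?p h x) \<and>
      Re (\<i> * of_real \<sigma> * (- nth_deriv 1 (V h) x * inverse (2 * csqrt (?p h x)))) \<le> - 2 * c"
    using phase_neighbourhood[OF assms(1,5,3) \<sigma>(1)] by blast
  \<comment> \<open>The phase is needed on \<open>|x - a| < 4 \<rho>\<close> and the cutoff is supported in \<open>|x - a| \<le> 2 \<rho>\<close>.\<close>
  define \<rho> where "\<rho> = d / 8"
  \<comment> \<open>\<open>h0 / 2\<close> rather than \<open>h0\<close>: the parameters then lie in a compact part of the interval on which \<open>V\<close> is continuous.\<close>
  define \<delta> where "\<delta> = min (min (h0 / 2) 1) \<rho>"
  have "\<rho> > 0" using \<open>d > 0\<close> by (simp add: \<rho>_def)
  have \<delta>: "0 < \<delta>" "\<delta> \<le> h0 / 2" "\<delta> \<le> 1" "\<delta> \<le> \<rho>"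
    using \<open>h0 > 0\<close> \<open>\<rho> > 0\<close> by (auto simp: \<delta>_def)
  let ?P = "{0<..<\<delta>}" and ?S = "{a - 4 * \<rho><..<a + 4 * \<rho>}"
  have V: "unif_smooth ?P UNIV V"
    by (rule unif_smooth_continuous_family[where J = "{0..\<delta>}" and T = "{0..<h0}"])
      (use assms(1-3) \<delta> in auto)
  have near_S: "\<eta>\<^sup>2 / 2 \<le> Re (?p h x)"
    "Re (\<i> * of_real \<sigma> * (- nth_deriv 1 (V h) x * inverse (2 * csqrt (?p h x)))) \<le> - 2 * c"
    if "h \<in> ?P" "x \<in> ?S" for h x
  proof -
    have "\<bar>x - a\<bar> < d / 2"
      unfolding abs_less_iff using that by (auto simp: \<rho>_def)
    moreover have "h < d / 8" using that \<delta> by (auto simp: \<rho>_def)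
    ultimately have "h + \<bar>x - a\<bar> < d" using \<open>d > 0\<close> by linarith
    then show "\<eta>\<^sup>2 / 2 \<le> Re (?p h x)"
      "Re (\<i> * of_real \<sigma> * (- nth_deriv 1 (V h) x * inverse (2 * csqrt (?p h x)))) \<le> - 2 * c"
      using near[of h x] that \<delta> \<open>h0 > 0\<close> by auto
  qed
  have VS: "unif_smooth ?P ?S V"
    using V by (rule unif_smooth_subset) auto
  obtain Ba where "\<And>h. h \<in> ?P \<Longrightarrow> cmod (V h a) \<le> Ba"
    using locally_boundedD[OF unif_smooth_locally_bounded[OF V] compact_insert[OF compact_empty] subset_UNIV]
    by (metis singletonI)
  then have Va: "unif_smooth ?P ?S (\<lambda>h x. V h a)"
    by (rule unif_smooth_const_in_x)
  have p: "unif_smooth ?P ?S ?p"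
    by (intro unif_smooth_diff unif_smooth_add unif_smooth_const Va VS)
  have dp: "dx ?p h x = - nth_deriv 1 (V h) x" if "h \<in> ?P" "x \<in> ?S" for h x
    using has_vector_derivative_diff[OF has_vector_derivative_const unif_smooth_has_dx[OF VS that]]
    by (intro vector_derivative_at) (simp add: nth_deriv_def)
  have pos: "\<eta>\<^sup>2 / 2 > 0" using assms(5) by simp
  note root = unif_smooth_csqrt(1,2)[OF p open_greaterThanLessThan pos near_S(1)]
  define w where "w = (\<lambda>h x. \<i> * of_real \<sigma> * csqrt (?p h x))"
  have w: "unif_smooth ?P ?S w"
    unfolding w_def by (intro unif_smooth_mult unif_smooth_const root(1))
  have dw: "dx w h x = \<i> * of_real \<sigma> * (- nth_deriv 1 (V h) x * inverse (2 * csqrt (?p h x)))"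
    if "h \<in> ?P" "x \<in> ?S" for h x
    using has_vector_derivative_mult_right[OF unif_smooth_csqrt(3)[OF p open_greaterThanLessThan pos near_S(1) that], of "\<i> * of_real \<sigma>"] dp[OF that]
    unfolding w_def by (intro vector_derivative_at) simp
  have iw: "unif_smooth ?P ?S (\<lambda>h x. inverse (w h x))"
    unfolding w_def inverse_mult_distrib by (intro unif_smooth_mult unif_smooth_const root(2))
  have smooth: "smooth (\<lambda>x. V h x - z h)" if "h \<in> ?P" for h
  proof (rule smooth_locally)
    have "unif_smooth {()} UNIV (\<lambda>_ x. V h x - z h)"
      by (intro unif_smooth_diff unif_smooth_const unif_smooth_member[OF V that])
    then show "\<exists>S. open S \<and> x \<in> S \<and> unif_smooth {()} S (\<lambda>_ x. V h x - z h)" for x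
      by (intro exI[of _ UNIV]) simp
  qed
  have quasimode: "\<exists>b>0. \<forall>h\<in>?P. \<exists>f\<in>test_functions. f \<noteq> (\<lambda>_. 0) \<and>
    norm (abs_L2 (schroedinger h (\<lambda>x. V h x - z h) f)) / norm (abs_L2 f) \<le> b * h ^ n" if "n > 0" for n
  proof (rule wkb_quasimode_family[where w = w and c = c, OF \<open>\<rho> > 0\<close> \<delta>(3,4) \<open>c > 0\<close> that w iw _ _ smooth])
    fix h x assume hx: "h \<in> ?P" "x \<in> ?S"
    have "0 < Re (?p h x)" using near_S(1)[OF hx] pos by linarith
    then have "?p h x \<noteq> 0" by (metis less_irrefl zero_complex.sel(1))
    moreover have "\<sigma> \<noteq> 0" using \<sigma>(2) by auto
    ultimately show "w h x \<noteq> 0"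
      unfolding w_def by (simp only: mult_eq_0_iff csqrt_eq_0 of_real_eq_0_iff complex_i_not_zero) simp
    have "(of_real \<sigma>)\<^sup>2 = (1 :: complex)"
      by (metis \<sigma>(2) of_real_1 of_real_power power2_eq_square)
    moreover have "(w h x)\<^sup>2 = \<i>\<^sup>2 * (of_real \<sigma>)\<^sup>2 * (csqrt (?p h x))\<^sup>2"
      by (simp only: w_def power_mult_distrib)
    ultimately show "(w h x)\<^sup>2 = V h x - z h"
      by (simp add: assms(7))
    show "Re (dx w h x) \<le> - 2 * c"
      unfolding dw[OF hx] by (rule near_S(2)[OF hx])
  next
    fix h assume "h \<in> ?P"
    show "Re (w h a) = 0" by (simp add: w_def)
  qed
  have "\<exists>b>0. \<exists>f. \<forall>h. 0 < h \<and> h < \<delta> \<longrightarrow> f h \<in> test_functions \<and> f h \<noteq> (\<lambda>_. 0) \<and>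
      norm (H h (abs_L2 (f h)) - z h *\<^sub>C abs_L2 (f h)) / norm (abs_L2 (f h)) \<le> b * h ^ n"
    if n: "n > 0" for n
  proof -
    obtain b where "b > 0" and b: "\<forall>h\<in>?P. \<exists>f. f \<in> test_functions \<and> f \<noteq> (\<lambda>_. 0) \<and>
      norm (abs_L2 (schroedinger h (\<lambda>x. V h x - z h) f)) / norm (abs_L2 f) \<le> b * h ^ n"
      using quasimode[OF n] by blast
    obtain f where f: "\<And>h. h \<in> ?P \<Longrightarrow> f h \<in> test_functions \<and> f h \<noteq> (\<lambda>_. 0) \<and>
      norm (abs_L2 (schroedinger h (\<lambda>x. V h x - z h) (f h))) / norm (abs_L2 (f h)) \<le> b * h ^ n"
      using bchoice[OF b] by blast
    have "f h \<in> test_functions \<and> f h \<noteq> (\<lambda>_. 0) \<and>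
      norm (H h (abs_L2 (f h)) - z h *\<^sub>C abs_L2 (f h)) / norm (abs_L2 (f h)) \<le> b * h ^ n"
      if "0 < h" "h < \<delta>" for h
      using f[of h] that \<delta> closed_extension_minus_scalar[OF assms(4) _ assms(2), of h "f h" "z h"] by simp
    then show ?thesis using \<open>b > 0\<close> by blast
  qed
  then show ?thesis
    using \<delta> by (intro exI[of _ \<delta>]) auto
qed

end
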